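(* Let $N\in\{1,2,3\}$, $a>0$, $\Delta t>0$, $\eta>0$, and let $\mathcal{A}\in\mathbb{R}^{m\times m}$ be the coefficient matrix of an $m$-stage SDIRK method, i.e. $\mathcal{A}$ is lower triangular with all diagonal entries equal to $\gamma>0$. Consider the ODE $\dot y=-Dy$ in $\mathbb{R}^d$, where $D\in\mathbb{R}^{d\times d}$ is the discrete (negative) Laplacian with diffusion coefficient $a$, periodic boundary conditions and mesh size $\Delta x$ (so $d=\Delta x^{-N}$). Then for all $\varepsilon>0$ there exists a constant $C_\varepsilon$, independent of the dimension $d$, such that for every $y_n\in\mathbb{R}^d$ and every starting value $\boldsymbol{x}_0\in\mathbb{R}^{md}$ the iterates $\boldsymbol{x}_k$ of the partitioned Runge-Kutta-Chebyshev iteration (defined in the context) converge to the SDIRK solution $\boldsymbol{Y}_{n+1}$ with the estimate $$\|\boldsymbol{x}_k-\boldsymbol{Y}_{n+1}\|_2\le C_\varepsilon\big(\alpha_s(\eta)+\varepsilon\big)^k\,\|\boldsymbol{x}_0-\boldsymbol{Y}_{n+1}\|_2,\qquad k\ge 0.$$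
   Context: Space discretisation. $\partial_t u=a\Delta u$ on $(0,1)^N$ with periodic boundary conditions is discretised by standard second order central finite differences on the uniform grid with mesh size $\Delta x$ ($1/\Delta x$ an integer) in each direction. $-D$ is the resulting matrix, so $D$ is symmetric positive semi-definite with eigenvalues in $[0,\lambda_{max}]$, $\lambda_{max}=4Na/\Delta x^2$. SDIRK solution. $\boldsymbol{Y}_{n+1}\in\mathbb{R}^{md}$ is the vector of internal stages, i.e. the solution of $\boldsymbol{Y}=\mathbbm{1}_m\otimes y_n-\Delta t(\mathcal{A}\otimes D)\boldsymbol{Y}$, where $\mathbbm{1}_m=(1,\dots,1)^T\in\mathbb{R}^m$. Parameters. $T_j$ is the Chebyshev polynomial of the first kind of degree $j$, $T_j(\cos\theta)=\cos(j\theta)$. Set $\ell=1$, $L=1+\gamma\Delta t\,\lambda_{max}$, $\kappa=L/\ell$, and $$s=\left\lceil\sqrt{(\kappa-1)\eta/2}\right\rceil,\quad \omega_0=1+\frac{\eta}{s^2},\quad \omega_1=\frac{T_s(\omega_0)}{T_s'(\omega_0)},\quad h=\frac{\omega_0-1}{\omega_1\ell},\quad \alpha_s(\eta)=\frac{1}{T_s(\omega_0)},$$ $$\mu_1=\frac{\omega_1}{\omega_0},\qquad \mu_j=\frac{2\omega_1T_{j-1}(\omega_0)}{T_j(\omega_0)},\qquad \nu_j=\frac{2\omega_0T_{j-1}(\omega_0)}{T_j(\omega_0)}\quad (j\ge2).$$ Partitioned Runge-Kutta-Chebyshev iteration (for an ODE with a linear diffusion term only). Let $$G_D(\boldsymbol{Y})=\mathbbm{1}_m\otimes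 y_n-\boldsymbol{Y}-\Delta t\,\gamma\,(I_m\otimes D)\boldsymbol{Y},\qquad G_A(\boldsymbol{Y})=-\Delta t\,\big((\mathcal{A}-\gamma I_m)\otimes D\big)\boldsymbol{Y}.$$ Given $\boldsymbol{x}_k\in\mathbb{R}^{md}$, put $G(\boldsymbol{x})=G_D(\boldsymbol{x})+G_A(\boldsymbol{x}_k)$ (with $G_A$ frozen at $\boldsymbol{x}_k$), set $\boldsymbol{x}_k^0=\boldsymbol{x}_k$, $\boldsymbol{x}_k^1=\boldsymbol{x}_k^0+h\mu_1G(\boldsymbol{x}_k)$, and for $j=2,\dots,s$, $$\boldsymbol{x}_k^j=\mu_jh\,G(\boldsymbol{x}_k^{j-1})+\nu_j\boldsymbol{x}_k^{j-1}-(\nu_j-1)\boldsymbol{x}_k^{j-2};$$ then $\boldsymbol{x}_{k+1}=\boldsymbol{x}_k^s$. "Independent of the dimension $d$" means that, $N,a,\Delta t,\eta,\mathcal{A},\varepsilon$ being given, the same constant works for all mesh sizes $\Delta x$. Note that $s$, $h$ and $\alpha_s(\eta)$ do depend on $\Delta x$ through $\kappa$. *)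

theory Defs
  imports
    Complex_Main
    "HOL-Computational_Algebra.Polynomial"
    "Jordan_Normal_Form.Matrix"
begin

section \<open>Chebyshev polynomials of the first kind\<close>

definition chebyshev :: "nat \<Rightarrow> real poly" where
  "chebyshev n = (THE p. \<forall>\<theta>. poly p (cos \<theta>) = cos (real n * \<theta>))"

lemma chebyshev_exists: "\<exists>p :: real poly. \<forall>\<theta>. poly p (cos \<theta>) = cos (real n * \<theta>)"
proof (induction n rule: less_induct)
  case (less n)
  consider "n = 0" | "n = 1" | k where "n = Suc (Suc k)"
    by (metis One_nat_def not0_implies_Suc)
  then show ?case
  proof cases
    case 1
    then show ?thesis by (intro exI[of _ "1"]) simp
  next
    case 2
    then show ?thesis by (intro exI[of _ "[:0, 1:]"]) simp
  next
    case (3 k)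
    obtain p where p: "\<And>\<theta>. poly p (cos \<theta>) = cos (real k * \<theta>)"
      using less.IH[of k] 3 by auto
    obtain q where q: "\<And>\<theta>. poly q (cos \<theta>) = cos (real (Suc k) * \<theta>)"
      using less.IH[of "Suc k"] 3 by auto
    have "poly ([:0, 2:] * q - p) (cos \<theta>) = cos (real n * \<theta>)" for \<theta>
    proof -
      have "real n * \<theta> = real (Suc k) * \<theta> + \<theta>" "real k * \<theta> = real (Suc k) * \<theta> - \<theta>"
        unfolding 3 by (simp_all add: algebra_simps)
      then show ?thesis
        by (simp only: poly_diff poly_mult p q cos_add cos_diff) simp
    qed
    then show ?thesis by blast
  qed
qed

lemma chebyshev_unique:
  fixes p q :: "real poly"
  assumes "\<And>\<theta>. poly p (cos \<theta>) = poly q (cos \<theta>)"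
  shows "p = q"
proof (rule ccontr)
  assume "p \<noteq> q"
  then have "finite {x. poly (p - q) x = 0}"
    by (intro poly_roots_finite) simp
  moreover have "{-1..1} \<subseteq> {x. poly (p - q) x = 0}"
  proof
    fix x :: real assume "x \<in> {-1..1}"
    then have "x = cos (arccos x)" by (simp add: cos_arccos)
    then show "x \<in> {x. poly (p - q) x = 0}"
      using assms[of "arccos x"] by simp
  qed
  ultimately have "finite {-1..1::real}" by (rule rev_finite_subset)
  then show False using infinite_Icc[of "-1::real" 1] by simp
qed

lemma chebyshev_cos: "poly (chebyshev n) (cos \<theta>) = cos (real n * \<theta>)"
proof -
  have "\<exists>!p :: real poly. \<forall>\<theta>. poly p (cos \<theta>) = cos (real n * \<theta>)"
    using chebyshev_exists[of n] by (auto intro!: chebyshev_unique)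
  from theI'[OF this] show ?thesis unfolding chebyshev_def by blast
qed


section \<open>Kronecker products and the Euclidean norm\<close>

definition kron :: "real mat \<Rightarrow> real mat \<Rightarrow> real mat" where
  "kron A B = mat (dim_row A * dim_row B) (dim_col A * dim_col B)
     (\<lambda>(i, j). A $$ (i div dim_row B, j div dim_col B) * B $$ (i mod dim_row B, j mod dim_col B))"

definition kron_vec :: "real vec \<Rightarrow> real vec \<Rightarrow> real vec" where
  "kron_vec u v = vec (dim_vec u * dim_vec v)
     (\<lambda>i. u $ (i div dim_vec v) * v $ (i mod dim_vec v))"

definition ones_vec :: "nat \<Rightarrow> real vec" where
  "ones_vec m = vec m (\<lambda>_. 1)"

definition norm2 :: "real vec \<Rightarrow> real" where
  "norm2 v = sqrt (v \<bullet> v)"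


section \<open>The periodic finite-difference Laplacian\<close>

text \<open>
  The grid has \<open>M\<close> points per direction, i.e. mesh size \<open>1 / M\<close>.  The grid points are numbered
  \<open>0, \<dots>, M ^ N - 1\<close>; the base-\<open>M\<close> digits of the number are the integer coordinates of the point.
\<close>

definition grid_coord :: "nat \<Rightarrow> nat \<Rightarrow> nat \<Rightarrow> nat" where
  "grid_coord M r i = (i div M ^ r) mod M"

text \<open>\<open>grid_next N M r i j\<close>: the point \<open>j\<close> is the periodic successor of \<open>i\<close> in direction \<open>r\<close>.\<close>

definition grid_next :: "nat \<Rightarrow> nat \<Rightarrow> nat \<Rightarrow> nat \<Rightarrow> nat \<Rightarrow> bool" where
  "grid_next N M r i j \<longleftrightarrow>
     (\<forall>q<N. grid_coord M q j = (if q = r then (grid_coord M q i + 1) mod M else grid_coord M q i))"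

definition mesh_size :: "nat \<Rightarrow> real" where
  "mesh_size M = 1 / real M"

text \<open>
  The matrix \<open>D\<close> of \<open>u \<mapsto> - a \<Delta> u\<close>: \<open>(D u) i\<close> is the sum over the directions \<open>r\<close> of
  \<open>a / \<Delta>x\<^sup>2 * (2 * u i - u (i + e\<^sub>r) - u (i - e\<^sub>r))\<close>.  The two neighbours are counted separately,
  so that they add up when they coincide with each other (\<open>M = 2\<close>) or with \<open>i\<close> (\<open>M = 1\<close>).
\<close>

definition neg_laplacian :: "nat \<Rightarrow> nat \<Rightarrow> real \<Rightarrow> real mat" where
  "neg_laplacian N M a = mat (M ^ N) (M ^ N) (\<lambda>(i, j).
     a / (mesh_size M)\<^sup>2 *
       (\<Sum>r<N. 2 * of_bool (i = j) - of_bool (grid_next N M r i j) - of_bool (grid_next N M r j i)))"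

definition lambda_max :: "nat \<Rightarrow> nat \<Rightarrow> real \<Rightarrow> real" where
  "lambda_max N M a = 4 * real N * a / (mesh_size M)\<^sup>2"


section \<open>The SDIRK stages\<close>

definition sdirk_matrix :: "nat \<Rightarrow> real \<Rightarrow> real mat \<Rightarrow> bool" where
  "sdirk_matrix m \<gamma> A \<longleftrightarrow> A \<in> carrier_mat m m \<and> \<gamma> > 0 \<and>
     (\<forall>i<m. \<forall>j<m. i < j \<longrightarrow> A $$ (i, j) = 0) \<and> (\<forall>i<m. A $$ (i, i) = \<gamma>)"

definition sdirk_solution ::
    "nat \<Rightarrow> real mat \<Rightarrow> real mat \<Rightarrow> real \<Rightarrow> real vec \<Rightarrow> real vec \<Rightarrow> bool" where
  "sdirk_solution m A D dt y Y \<longleftrightarrow> Y \<in> carrier_vec (m * dim_vec y) \<and>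
     Y = kron_vec (ones_vec m) y - dt \<cdot>\<^sub>v (kron A D *\<^sub>v Y)"


section \<open>Parameters of the Runge-Kutta-Chebyshev iteration\<close>

definition rkc_ell :: real where
  "rkc_ell = 1"

definition rkc_L :: "real \<Rightarrow> real \<Rightarrow> real \<Rightarrow> real" where
  "rkc_L \<gamma> dt lmax = 1 + \<gamma> * dt * lmax"

definition rkc_kappa :: "real \<Rightarrow> real \<Rightarrow> real \<Rightarrow> real" where
  "rkc_kappa \<gamma> dt lmax = rkc_L \<gamma> dt lmax / rkc_ell"

definition rkc_stages :: "real \<Rightarrow> real \<Rightarrow> nat" where
  "rkc_stages \<kappa> \<eta> = nat \<lceil>sqrt ((\<kappa> - 1) * \<eta> / 2)\<rceil>"

definition rkc_omega0 :: "real \<Rightarrow> nat \<Rightarrow> real" where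
  "rkc_omega0 \<eta> s = 1 + \<eta> / (real s)\<^sup>2"

definition rkc_omega1 :: "real \<Rightarrow> nat \<Rightarrow> real" where
  "rkc_omega1 \<eta> s =
     poly (chebyshev s) (rkc_omega0 \<eta> s) / poly (pderiv (chebyshev s)) (rkc_omega0 \<eta> s)"

definition rkc_h :: "real \<Rightarrow> nat \<Rightarrow> real" where
  "rkc_h \<eta> s = (rkc_omega0 \<eta> s - 1) / (rkc_omega1 \<eta> s * rkc_ell)"

definition rkc_alpha :: "real \<Rightarrow> nat \<Rightarrow> real" where
  "rkc_alpha \<eta> s = 1 / poly (chebyshev s) (rkc_omega0 \<eta> s)"

text \<open>Only the values at \<open>j \<ge> 1\<close> of \<open>rkc_mu\<close> and at \<open>j \<ge> 2\<close> of \<open>rkc_nu\<close> are meaningful.\<close>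

definition rkc_mu :: "real \<Rightarrow> nat \<Rightarrow> nat \<Rightarrow> real" where
  "rkc_mu \<eta> s j = (if j = 1 then rkc_omega1 \<eta> s / rkc_omega0 \<eta> s
     else 2 * rkc_omega1 \<eta> s * poly (chebyshev (j - 1)) (rkc_omega0 \<eta> s)
            / poly (chebyshev j) (rkc_omega0 \<eta> s))"

definition rkc_nu :: "real \<Rightarrow> nat \<Rightarrow> nat \<Rightarrow> real" where
  "rkc_nu \<eta> s j = 2 * rkc_omega0 \<eta> s * poly (chebyshev (j - 1)) (rkc_omega0 \<eta> s)
            / poly (chebyshev j) (rkc_omega0 \<eta> s)"


section \<open>The partitioned Runge-Kutta-Chebyshev iteration\<close>

definition prkc_G_D ::
    "nat \<Rightarrow> real \<Rightarrow> real mat \<Rightarrow> real \<Rightarrow> real vec \<Rightarrow> real vec \<Rightarrow> real vec" where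
  "prkc_G_D m \<gamma> D dt y Y =
     kron_vec (ones_vec m) y - Y - (dt * \<gamma>) \<cdot>\<^sub>v (kron (1\<^sub>m m) D *\<^sub>v Y)"

definition prkc_G_A ::
    "nat \<Rightarrow> real \<Rightarrow> real mat \<Rightarrow> real mat \<Rightarrow> real \<Rightarrow> real vec \<Rightarrow> real vec" where
  "prkc_G_A m \<gamma> A D dt Y = (- dt) \<cdot>\<^sub>v (kron (A - \<gamma> \<cdot>\<^sub>m 1\<^sub>m m) D *\<^sub>v Y)"

fun rkc_inner ::
    "(real vec \<Rightarrow> real vec) \<Rightarrow> real \<Rightarrow> nat \<Rightarrow> real vec \<Rightarrow> nat \<Rightarrow> real vec" where
  "rkc_inner G \<eta> s x 0 = x"
| "rkc_inner G \<eta> s x (Suc 0) = x + (rkc_h \<eta> s * rkc_mu \<eta> s 1) \<cdot>\<^sub>v G x"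
| "rkc_inner G \<eta> s x (Suc (Suc j)) =
     (rkc_mu \<eta> s (Suc (Suc j)) * rkc_h \<eta> s) \<cdot>\<^sub>v G (rkc_inner G \<eta> s x (Suc j))
     + rkc_nu \<eta> s (Suc (Suc j)) \<cdot>\<^sub>v rkc_inner G \<eta> s x (Suc j)
     - (rkc_nu \<eta> s (Suc (Suc j)) - 1) \<cdot>\<^sub>v rkc_inner G \<eta> s x j"

definition prkc_step ::
    "nat \<Rightarrow> real \<Rightarrow> real mat \<Rightarrow> real mat \<Rightarrow> real \<Rightarrow> real \<Rightarrow> nat \<Rightarrow> real vec \<Rightarrow> real vec \<Rightarrow> real vec" where
  "prkc_step m \<gamma> A D dt \<eta> s y x =
     rkc_inner (\<lambda>z. prkc_G_D m \<gamma> D dt y z + prkc_G_A m \<gamma> A D dt x) \<eta> s x s"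

fun prkc_iterate ::
    "nat \<Rightarrow> real \<Rightarrow> real mat \<Rightarrow> real mat \<Rightarrow> real \<Rightarrow> real \<Rightarrow> nat \<Rightarrow> real vec \<Rightarrow> real vec \<Rightarrow> nat \<Rightarrow> real vec" where
  "prkc_iterate m \<gamma> A D dt \<eta> s y x\<^sub>0 0 = x\<^sub>0"
| "prkc_iterate m \<gamma> A D dt \<eta> s y x\<^sub>0 (Suc k) =
     prkc_step m \<gamma> A D dt \<eta> s y (prkc_iterate m \<gamma> A D dt \<eta> s y x\<^sub>0 k)"

end

theory Submission
  imports Defs "HOL-Analysis.L2_Norm" "Jordan_Normal_Form.Determinant"
begin

text \<open>
  The matrix \<open>D\<close> is \<open>c (1 - W)\<close> with \<open>c = \<lambda>\<^sub>m\<^sub>a\<^sub>x / 2\<close>, where \<open>W\<close> averages over the \<open>2 N\<close> neighbours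
  of a grid point and is therefore symmetric, nonnegative and substochastic.  On one stage, the
  error of the inner iteration after \<open>s\<close> substeps is \<open>T\<^sub>s(X) w / T\<^sub>s(\<omega>\<^sub>0)\<close> with
  \<open>X = \<omega>\<^sub>0 - (\<omega>\<^sub>0 - 1) (1 + \<gamma> \<Delta>t D) = (1 - t) + t W\<close>, and the choice of \<open>s\<close> gives \<open>t \<in> [0, 1]\<close>.
  Hence \<open>\<parallel>T\<^sub>s(X)\<parallel> \<le> 1\<close> and the inner iteration contracts by \<open>\<alpha>\<^sub>s(\<eta>)\<close> towards a point whose distance from the
  solution is bounded, uniformly in the mesh size, by the errors of the preceding stages.  The
  resulting recurrence for the stage errors is lower triangular with diagonal \<open>\<alpha>\<^sub>s(\<eta>)\<close>, and
  rescaling the stages makes its off-diagonal part smaller than \<open>\<epsilon>\<close>.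
\<close>


section \<open>Chebyshev polynomials to the right of 1\<close>

lemma chebyshev_0: "chebyshev 0 = 1"
  by (rule chebyshev_unique) (simp add: chebyshev_cos)

lemma chebyshev_1: "chebyshev (Suc 0) = [:0, 1:]"
  by (rule chebyshev_unique) (simp add: chebyshev_cos)

lemma chebyshev_Suc_Suc:
  "chebyshev (Suc (Suc n)) = [:0, 2:] * chebyshev (Suc n) - chebyshev n"
proof (rule chebyshev_unique)
  fix \<theta> :: real
  have "real (Suc (Suc n)) * \<theta> = real (Suc n) * \<theta> + \<theta>" "real n * \<theta> = real (Suc n) * \<theta> - \<theta>"
    by (simp_all add: algebra_simps)
  then show "poly (chebyshev (Suc (Suc n))) (cos \<theta>)
      = poly ([:0, 2:] * chebyshev (Suc n) - chebyshev n) (cos \<theta>)"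
    by (simp only: poly_diff poly_mult chebyshev_cos cos_add cos_diff) simp
qed

lemma poly_chebyshev_Suc_Suc:
  "poly (chebyshev (Suc (Suc n))) x = 2 * x * poly (chebyshev (Suc n)) x - poly (chebyshev n) x"
  by (simp add: chebyshev_Suc_Suc)

text \<open>The two parts feed each other:
  \<open>T n \<le> x * T n \<le> T (Suc n) \<le> x * T (Suc n)\<close>, so subtracting
  \<open>T n\<close> from \<open>2 * x * T (Suc n)\<close> in the recurrence leaves at least
  \<open>x * T (Suc n)\<close>.\<close>

lemma chebyshev_growth:
  assumes "x \<ge> 1"
  shows "poly (chebyshev n) x \<ge> 1 \<and> poly (chebyshev (Suc n)) x \<ge> x * poly (chebyshev n) x"
proof (induction n)
  case 0
  show ?case by (simp add: chebyshev_0 chebyshev_1)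
next
  case (Suc n)
  let ?T = "\<lambda>k. poly (chebyshev k) x"
  have "?T n \<le> x * ?T n" using Suc assms by (simp add: mult_le_cancel_right1)
  then have 1: "?T n \<le> ?T (Suc n)" "1 \<le> ?T (Suc n)" using Suc by linarith+
  then have "?T (Suc n) \<le> x * ?T (Suc n)" using assms by (simp add: mult_le_cancel_right1)
  then have "x * ?T (Suc n) \<le> ?T (Suc (Suc n))"
    using 1 poly_chebyshev_Suc_Suc[of n x] by linarith
  with 1 show ?case by blast
qed

lemma chebyshev_ge_1: "x \<ge> 1 \<Longrightarrow> poly (chebyshev n) x \<ge> 1"
  using chebyshev_growth by blast

text \<open>Strictness is what puts \<open>rkc_alpha\<close> below 1, so that the iteration
  converges and does not merely stay bounded.\<close>

lemma chebyshev_gt_1: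
  assumes "x > 1" "n \<ge> 1"
  shows "poly (chebyshev n) x > 1"
proof -
  obtain k where n: "n = Suc k" using assms(2) by (cases n) auto
  have "x * 1 \<le> x * poly (chebyshev k) x"
    using chebyshev_ge_1[of x k] assms(1) by (intro mult_left_mono) auto
  also have "\<dots> \<le> poly (chebyshev n) x"
    using chebyshev_growth[of x k] assms(1) unfolding n by auto
  finally show ?thesis using assms(1) by simp
qed

text \<open>Differentiating the three-term recurrence adds the term \<open>2 * T (Suc n)\<close>,
  which is at least 2, so the increments stay positive. The resulting positivity keeps the
  denominator of \<open>rkc_omega1\<close> away from 0.\<close>

lemma pderiv_chebyshev_growth:
  assumes "x \<ge> 1"
  shows "poly (pderiv (chebyshev n)) x \<ge> 0 \<and>
    poly (pderiv (chebyshev (Suc n))) x \<ge> poly (pderiv (chebyshev n)) x + 1"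
proof (induction n)
  case 0
  show ?case by (simp add: chebyshev_0 chebyshev_1 pderiv_pCons)
next
  case (Suc n)
  let ?T' = "\<lambda>k. poly (pderiv (chebyshev k)) x"
  have "?T' (Suc (Suc n)) = 2 * poly (chebyshev (Suc n)) x + 2 * (x * ?T' (Suc n)) - ?T' n"
    by (simp add: chebyshev_Suc_Suc pderiv_diff pderiv_mult pderiv_smult pderiv_pCons algebra_simps)
  moreover have "?T' (Suc n) \<le> x * ?T' (Suc n)"
    using Suc assms by (simp add: mult_le_cancel_right1)
  ultimately show ?case using chebyshev_ge_1[OF assms, of "Suc n"] Suc by linarith
qed

lemma pderiv_chebyshev_pos:
  assumes "x \<ge> 1" "n \<ge> 1"
  shows "poly (pderiv (chebyshev n)) x > 0"
  using pderiv_chebyshev_growth[OF assms(1), of "n - 1"] assms(2) by simp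


section \<open>Symmetric substochastic kernels\<close>

text \<open>Matrix-vector product on plain functions, of which only the values below
  \<open>d\<close> enter; single stages of a block vector can then be handled without carrier
  conditions.\<close>

definition kernel_app :: "nat \<Rightarrow> (nat \<Rightarrow> nat \<Rightarrow> real) \<Rightarrow> (nat \<Rightarrow> real) \<Rightarrow> nat \<Rightarrow> real" where
  "kernel_app d K f p = (\<Sum>q<d. K p q * f q)"

text \<open>An entrywise criterion for a symmetric operator with spectrum in [-1, 1], easy to check
  for an average over grid neighbours.\<close>

definition symm_substochastic :: "nat \<Rightarrow> (nat \<Rightarrow> nat \<Rightarrow> real) \<Rightarrow> bool" where
  "symm_substochastic d K \<longleftrightarrow> (\<forall>p<d. \<forall>q<d. K p q = K q p \<and> K p q \<ge> 0) \<and> (\<forall>p<d. (\<Sum>q<d. K p q) \<le> 1)"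

lemma kernel_app_cong:
  "(\<And>q. q < d \<Longrightarrow> f q = g q) \<Longrightarrow> kernel_app d K f p = kernel_app d K g p"
  unfolding kernel_app_def by (intro sum.cong) auto

lemma kernel_app_add: "kernel_app d K (\<lambda>q. f q + g q) p = kernel_app d K f p + kernel_app d K g p"
  by (simp add: kernel_app_def distrib_left sum.distrib)

lemma kernel_app_diff: "kernel_app d K (\<lambda>q. f q - g q) p = kernel_app d K f p - kernel_app d K g p"
  by (simp add: kernel_app_def right_diff_distrib sum_subtractf)

lemma kernel_app_cmult: "kernel_app d K (\<lambda>q. c * f q) p = c * kernel_app d K f p"
  by (simp add: kernel_app_def sum_distrib_left mult_ac)

lemma kernel_app_self_adjoint:
  assumes "symm_substochastic d K"
  shows "(\<Sum>p<d. f p * kernel_app d K g p) = (\<Sum>p<d. kernel_app d K f p * g p)"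
proof -
  have "(\<Sum>p<d. f p * kernel_app d K g p) = (\<Sum>p<d. \<Sum>q<d. f p * K p q * g q)"
    by (simp add: kernel_app_def sum_distrib_left mult_ac)
  also have "\<dots> = (\<Sum>q<d. \<Sum>p<d. f p * K p q * g q)" by (rule sum.swap)
  also have "\<dots> = (\<Sum>q<d. \<Sum>p<d. K q p * f p * g q)"
    using assms unfolding symm_substochastic_def by (intro sum.cong) auto
  also have "\<dots> = (\<Sum>p<d. kernel_app d K f p * g p)"
    by (simp add: kernel_app_def sum_distrib_right)
  finally show ?thesis .
qed

lemma L2_set_power2: "(L2_set f I)\<^sup>2 = (\<Sum>i\<in>I. (f i)\<^sup>2)"
  unfolding L2_set_def by (simp add: sum_nonneg)

text \<open>Schur's test, from \<open>2 g\<^sub>p h\<^sub>q \<le> g\<^sub>p\<^sup>2 + h\<^sub>q\<^sup>2\<close> weighted by \<open>K p q\<close>.\<close>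

lemma kernel_app_contraction:
  assumes K: "symm_substochastic d K"
  shows "L2_set (kernel_app d K f) {..<d} \<le> L2_set f {..<d}"
proof -
  have bilin: "(\<Sum>p<d. g p * kernel_app d K h p) \<le> ((\<Sum>p<d. (g p)\<^sup>2) + (\<Sum>p<d. (h p)\<^sup>2)) / 2" for g h
  proof -
    have nn: "K p q \<ge> 0" if "p < d" "q < d" for p q
      using K that unfolding symm_substochastic_def by blast
    have row: "(\<Sum>q<d. K p q) \<le> 1" if "p < d" for p
      using K that unfolding symm_substochastic_def by blast
    have col: "(\<Sum>p<d. K p q) \<le> 1" if "q < d" for q
    proof -
      have "(\<Sum>p<d. K p q) = (\<Sum>p<d. K q p)"
        using K that unfolding symm_substochastic_def by (intro sum.cong) auto
      then show ?thesis using row[OF that] by simp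
    qed
    have "(\<Sum>p<d. g p * kernel_app d K h p) = (\<Sum>p<d. \<Sum>q<d. K p q * (g p * h q))"
      by (simp add: kernel_app_def sum_distrib_left mult_ac)
    also have "\<dots> \<le> (\<Sum>p<d. \<Sum>q<d. K p q * (((g p)\<^sup>2 + (h q)\<^sup>2) / 2))"
    proof (intro sum_mono mult_left_mono)
      fix p q
      show "g p * h q \<le> ((g p)\<^sup>2 + (h q)\<^sup>2) / 2"
        using sum_squares_bound[of "g p" "h q"] by simp
    qed (use nn in auto)
    also have "\<dots> = ((\<Sum>p<d. \<Sum>q<d. K p q * (g p)\<^sup>2) + (\<Sum>p<d. \<Sum>q<d. K p q * (h q)\<^sup>2)) / 2"
      by (simp add: sum.distrib[symmetric] sum_divide_distrib distrib_left add_divide_distrib)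
    also have "(\<Sum>p<d. \<Sum>q<d. K p q * (h q)\<^sup>2) = (\<Sum>q<d. \<Sum>p<d. K p q * (h q)\<^sup>2)"
      by (rule sum.swap)
    also have "(\<Sum>p<d. \<Sum>q<d. K p q * (g p)\<^sup>2) \<le> (\<Sum>p<d. (g p)\<^sup>2)"
    proof (rule sum_mono)
      fix p assume "p \<in> {..<d}"
      then show "(\<Sum>q<d. K p q * (g p)\<^sup>2) \<le> (g p)\<^sup>2"
        using mult_right_mono[OF row[of p], of "(g p)\<^sup>2"] by (simp add: sum_distrib_right)
    qed
    also have "(\<Sum>q<d. \<Sum>p<d. K p q * (h q)\<^sup>2) \<le> (\<Sum>q<d. (h q)\<^sup>2)"
    proof (rule sum_mono)
      fix q assume "q \<in> {..<d}"
      then show "(\<Sum>p<d. K p q * (h q)\<^sup>2) \<le> (h q)\<^sup>2"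
        using mult_right_mono[OF col[of q], of "(h q)\<^sup>2"] by (simp add: sum_distrib_right)
    qed
    finally show ?thesis by (simp add: divide_right_mono)
  qed
  \<comment> \<open>Testing with \<open>K f\<close> itself gives
    \<open>|K f|^2 \<le> (|K f|^2 + |f|^2) / 2\<close>, which is the contraction.\<close>
  from bilin[of "kernel_app d K f" f]
  have "(\<Sum>p<d. (kernel_app d K f p)\<^sup>2) \<le> (\<Sum>p<d. (f p)\<^sup>2)"
    by (simp add: power2_eq_square)
  then show ?thesis unfolding L2_set_def by simp
qed

text \<open>Cauchy-Schwarz and the contraction. In other words \<open>1 - K\<close> is positive
  semidefinite.\<close>

lemma kernel_app_inner_le:
  assumes K: "symm_substochastic d K"
  shows "(\<Sum>p<d. f p * kernel_app d K f p) \<le> (\<Sum>p<d. (f p)\<^sup>2)"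
proof -
  have "(\<Sum>p<d. f p * kernel_app d K f p) \<le> (\<Sum>p<d. \<bar>f p\<bar> * \<bar>kernel_app d K f p\<bar>)"
    by (intro sum_mono) (metis abs_mult abs_ge_self)
  also have "\<dots> \<le> L2_set f {..<d} * L2_set (kernel_app d K f) {..<d}"
    by (rule L2_set_mult_ineq)
  also have "\<dots> \<le> L2_set f {..<d} * L2_set f {..<d}"
    by (intro mult_left_mono kernel_app_contraction K L2_set_nonneg)
  finally show ?thesis by (simp add: L2_set_power2 flip: power2_eq_square)
qed

text \<open>\<open>t\<close> is arbitrary: values in [0, 1] give the kernel of the Chebyshev
  iteration, while \<open>t = - b\<close> gives the implicit operator
  \<open>1 + b (1 - K)\<close>.\<close>

lemma kernel_app_lazy:
  assumes "p < d"
  shows "kernel_app d (\<lambda>p q. (1 - t) * of_bool (p = q) + t * K p q) f p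
    = (1 - t) * f p + t * kernel_app d K f p"
proof -
  have "kernel_app d (\<lambda>p q. (1 - t) * of_bool (p = q) + t * K p q) f p
      = (\<Sum>q<d. (if p = q then (1 - t) * f q else 0) + t * (K p q * f q))"
    unfolding kernel_app_def by (intro sum.cong) (auto simp: distrib_right)
  then show ?thesis using assms by (simp add: kernel_app_def sum.distrib sum_distrib_left)
qed

lemma symm_substochastic_lazy:
  assumes "symm_substochastic d K" "0 \<le> t" "t \<le> 1"
  shows "symm_substochastic d (\<lambda>p q. (1 - t) * of_bool (p = q) + t * K p q)"
  unfolding symm_substochastic_def
proof (intro conjI allI impI)
  fix p assume p: "p < d"
  have "(\<Sum>q<d. (1 - t) * of_bool (p = q) + t * K p q) = (1 - t) + t * (\<Sum>q<d. K p q)"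
    using kernel_app_lazy[OF p, of t K "\<lambda>_. 1"] by (simp add: kernel_app_def)
  also have "\<dots> \<le> (1 - t) + t * 1"
    using assms p unfolding symm_substochastic_def by (intro add_left_mono mult_left_mono) auto
  also have "\<dots> = 1" by simp
  finally show "(\<Sum>q<d. (1 - t) * of_bool (p = q) + t * K p q) \<le> 1" .
qed (use assms in \<open>auto simp: symm_substochastic_def\<close>)

section \<open>Chebyshev polynomials of a kernel\<close>

text \<open>The addition formulas \<open>T (n+1) = x T n - (1 - x^2) U (n-1)\<close> and
  \<open>U n = x U (n-1) + T n\<close> with the kernel in place of \<open>x\<close>, applied to
  \<open>w\<close> and started from \<open>U (-1) = 0\<close>.\<close>

fun cheb_pair :: "nat \<Rightarrow> (nat \<Rightarrow> nat \<Rightarrow> real) \<Rightarrow> (nat \<Rightarrow> real) \<Rightarrow> nat \<Rightarrow> (nat \<Rightarrow> real) \<times> (nat \<Rightarrow> real)" where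
  "cheb_pair d K w 0 = (w, \<lambda>_. 0)"
| "cheb_pair d K w (Suc n) = (case cheb_pair d K w n of (t, u) \<Rightarrow>
     (\<lambda>p. kernel_app d K t p - u p + kernel_app d K (kernel_app d K u) p,
      \<lambda>p. kernel_app d K u p + t p))"

text \<open>With \<open>t = T\<^sub>n(K) w\<close> and \<open>u = U\<^sub>n\<^sub>-\<^sub>1(K) w\<close> this is the identity
  \<open>T\<^sub>n(x)\<^sup>2 + (1 - x\<^sup>2) U\<^sub>n\<^sub>-\<^sub>1(x)\<^sup>2 = 1\<close>, which replaces the spectral theorem.\<close>

lemma cheb_pair_invariant:
  assumes K: "symm_substochastic d K" and "cheb_pair d K w n = (t, u)"
  shows "(\<Sum>p<d. (t p)\<^sup>2) + (\<Sum>p<d. (u p)\<^sup>2) - (\<Sum>p<d. (kernel_app d K u p)\<^sup>2) = (\<Sum>p<d. (w p)\<^sup>2)"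
  using assms(2)
proof (induction n arbitrary: t u)
  case 0
  then show ?case by (auto simp: kernel_app_def)
next
  case (Suc n)
  obtain t0 u0 where tu0: "cheb_pair d K w n = (t0, u0)" by force
  define a v c where "a = kernel_app d K t0" and "v = kernel_app d K u0" and "c = kernel_app d K v"
  have t: "t = (\<lambda>p. a p - u0 p + c p)" and u: "u = (\<lambda>p. v p + t0 p)"
    using Suc.prems tu0 by (auto simp: a_def v_def c_def)
  have Ku: "kernel_app d K u = (\<lambda>p. c p + a p)"
    unfolding u c_def a_def by (rule ext) (rule kernel_app_add)
  \<comment> \<open>Moving one \<open>K\<close> across the inner product makes both cross terms of
    the expansion below vanish after summation.\<close>
  have 1: "(\<Sum>p<d. u0 p * a p) = (\<Sum>p<d. v p * t0 p)"
    unfolding a_def v_def by (rule kernel_app_self_adjoint[OF K])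
  have 2: "(\<Sum>p<d. u0 p * c p) = (\<Sum>p<d. v p * v p)"
    unfolding c_def by (subst kernel_app_self_adjoint[OF K]) (simp add: v_def)
  have "(\<Sum>p<d. (t p)\<^sup>2) + (\<Sum>p<d. (u p)\<^sup>2) - (\<Sum>p<d. (kernel_app d K u p)\<^sup>2)
      = (\<Sum>p<d. (t0 p)\<^sup>2 + (u0 p)\<^sup>2 - (v p)\<^sup>2
          + 2 * (v p * t0 p - u0 p * a p) + 2 * (v p * v p - u0 p * c p))"
    unfolding Ku unfolding t u sum.distrib[symmetric] sum_subtractf[symmetric]
    by (intro sum.cong) (simp_all add: power2_eq_square algebra_simps)
  also have "\<dots> = (\<Sum>p<d. (t0 p)\<^sup>2) + (\<Sum>p<d. (u0 p)\<^sup>2) - (\<Sum>p<d. (v p)\<^sup>2)"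
    using 1 2 by (simp add: sum.distrib sum_subtractf sum_distrib_left[symmetric])
  also have "\<dots> = (\<Sum>p<d. (w p)\<^sup>2)" using Suc.IH[OF tu0] by (simp add: v_def)
  finally show ?case .
qed

text \<open>Eliminating the second component recovers the three-term recurrence, which is the form
  in which the inner iteration appears.\<close>

lemma cheb_pair_recurrence:
  "fst (cheb_pair d K w (Suc (Suc n))) p
    = 2 * kernel_app d K (fst (cheb_pair d K w (Suc n))) p - fst (cheb_pair d K w n) p"
proof -
  obtain t u where tu: "cheb_pair d K w n = (t, u)" by force
  have "kernel_app d K (kernel_app d K (\<lambda>p. kernel_app d K u p + t p)) p
     = kernel_app d K (kernel_app d K (kernel_app d K u)) p + kernel_app d K (kernel_app d K t) p"
    by (simp add: kernel_app_add[abs_def])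
  then show ?thesis
    by (simp add: tu kernel_app_add kernel_app_diff)
qed

text \<open>Operator form of \<open>|T n| \<le> 1\<close> on [-1, 1]: below \<open>d\<close> the
  sequence is the first component of \<open>cheb_pair\<close>, and in the invariant the surplus
  \<open>|u|^2 - |K u|^2\<close> is nonnegative by the contraction.\<close>

lemma chebyshev_recurrence_contraction:
  assumes K: "symm_substochastic d K"
    and t1: "\<And>p. p < d \<Longrightarrow> t (Suc 0) p = kernel_app d K (t 0) p"
    and t2: "\<And>n p. p < d \<Longrightarrow> t (Suc (Suc n)) p = 2 * kernel_app d K (t (Suc n)) p - t n p"
  shows "L2_set (t n) {..<d} \<le> L2_set (t 0) {..<d}"
proof -
  have "\<forall>p<d. t n p = fst (cheb_pair d K (t 0) n) p \<and>
      t (Suc n) p = fst (cheb_pair d K (t 0) (Suc n)) p"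
  proof (induction n)
    case 0
    show ?case by (simp add: t1) (simp add: kernel_app_def)
  next
    case (Suc n)
    show ?case
    proof (intro allI impI conjI)
      fix p assume p: "p < d"
      then show "t (Suc n) p = fst (cheb_pair d K (t 0) (Suc n)) p" using Suc by blast
      have "t (Suc (Suc n)) p = 2 * kernel_app d K (t (Suc n)) p - t n p" by (rule t2[OF p])
      also have "\<dots> = 2 * kernel_app d K (fst (cheb_pair d K (t 0) (Suc n))) p
          - fst (cheb_pair d K (t 0) n) p"
        using Suc p by (metis kernel_app_cong)
      also have "\<dots> = fst (cheb_pair d K (t 0) (Suc (Suc n))) p" by (rule cheb_pair_recurrence[symmetric])
      finally show "t (Suc (Suc n)) p = fst (cheb_pair d K (t 0) (Suc (Suc n))) p" .
    qed
  qed
  moreover obtain t' u where tu: "cheb_pair d K (t 0) n = (t', u)" by force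
  ultimately have eq: "t n p = t' p" if "p < d" for p using that by simp
  have "(\<Sum>p<d. (kernel_app d K u p)\<^sup>2) \<le> (\<Sum>p<d. (u p)\<^sup>2)"
    using kernel_app_contraction[OF K, of u] unfolding L2_set_def by simp
  then have "(\<Sum>p<d. (t' p)\<^sup>2) \<le> (\<Sum>p<d. (t 0 p)\<^sup>2)"
    using cheb_pair_invariant[OF K tu] by linarith
  then have "L2_set t' {..<d} \<le> L2_set (t 0) {..<d}" unfolding L2_set_def by simp
  moreover have "L2_set (t n) {..<d} = L2_set t' {..<d}" by (rule L2_set_cong) (auto simp: eq)
  ultimately show ?thesis by simp
qed


section \<open>Implicit diffusion steps\<close>

text \<open>A trivial null space means a nonzero determinant, hence an inverse. Solvability of the
  implicit steps and of the full stage system thus reduces to injectivity.\<close>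

lemma square_system_solvable:
  fixes c :: "nat \<Rightarrow> nat \<Rightarrow> real"
  assumes inj: "\<And>f. (\<And>p. p < n \<Longrightarrow> kernel_app n c f p = 0) \<Longrightarrow> (\<And>p. p < n \<Longrightarrow> f p = 0)"
  shows "\<exists>f. \<forall>p<n. kernel_app n c f p = z p"
proof -
  define B where "B = mat n n (\<lambda>(p, q). c p q)"
  have B: "B \<in> carrier_mat n n" by (simp add: B_def)
  have app: "(B *\<^sub>v v) $ p = kernel_app n c (($) v) p" if "v \<in> carrier_vec n" "p < n" for v p
    using that by (auto simp: B_def scalar_prod_def kernel_app_def lessThan_atLeast0)
  have "det B \<noteq> 0"
  proof
    assume "det B = 0"
    then obtain v where v: "v \<in> carrier_vec n" "v \<noteq> 0\<^sub>v n" "B *\<^sub>v v = 0\<^sub>v n"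
      using det_0_iff_vec_prod_zero_field[OF B] by blast
    then have "kernel_app n c (($) v) p = 0" if "p < n" for p
      using app[OF v(1) that] that by simp
    then have "v $ p = 0" if "p < n" for p using inj that by blast
    then have "v = 0\<^sub>v n" using v(1) by (intro eq_vecI) auto
    with v(2) show False by simp
  qed
  \<comment> \<open>The \<open>()\<close> only fills the extra record parameter of
    \<open>ring_mat\<close>; a right inverse is what is extracted.\<close>
  then obtain C where C: "C \<in> carrier_mat n n" "B * C = 1\<^sub>m n"
    using det_non_zero_imp_unit[OF B, of "()"] by (auto simp: Units_def ring_mat_def)
  define b where "b = vec n z"
  have b: "b \<in> carrier_vec n" by (simp add: b_def)
  have "B *\<^sub>v (C *\<^sub>v b) = b" using B C b by (simp flip: assoc_mult_mat_vec)
  then have "kernel_app n c (($) (C *\<^sub>v b)) p = z p" if "p < n" for p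
    using app[of "C *\<^sub>v b" p] C b that by (simp add: b_def)
  then show ?thesis by blast
qed

text \<open>Pairing the equation with \<open>g\<close> and dropping the semidefinite term gives
  \<open>|g|^2 \<le> <g, z>\<close>. The bound holds with constant 1 for every
  \<open>b \<ge> 0\<close>, so it does not deteriorate as the mesh is refined.\<close>

lemma implicit_step_lower_bound:
  assumes W: "symm_substochastic d W" and "b \<ge> 0"
    and g: "\<And>p. p < d \<Longrightarrow> g p + b * (g p - kernel_app d W g p) = z p"
  shows "L2_set g {..<d} \<le> L2_set z {..<d}"
proof -
  have "(\<Sum>p<d. g p * z p) = (\<Sum>p<d. (g p)\<^sup>2) + b * ((\<Sum>p<d. (g p)\<^sup>2) - (\<Sum>p<d. g p * kernel_app d W g p))"
    by (simp add: g[symmetric] algebra_simps power2_eq_square sum.distrib sum_subtractf sum_distrib_left)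
  also have "\<dots> \<ge> (\<Sum>p<d. (g p)\<^sup>2)"
    using kernel_app_inner_le[OF W] \<open>b \<ge> 0\<close> by simp
  finally have "(L2_set g {..<d})\<^sup>2 \<le> (\<Sum>p<d. g p * z p)" by (simp add: L2_set_power2)
  also have "\<dots> \<le> (\<Sum>p<d. \<bar>g p\<bar> * \<bar>z p\<bar>)"
    by (intro sum_mono) (metis abs_mult abs_ge_self)
  also have "\<dots> \<le> L2_set g {..<d} * L2_set z {..<d}"
    by (rule L2_set_mult_ineq)
  finally show ?thesis
    using L2_set_nonneg[of g "{..<d}"] L2_set_nonneg[of z "{..<d}"]
    by (cases "L2_set g {..<d} = 0") (auto simp: power2_eq_square)
qed

lemma implicit_step_injective:
  assumes "symm_substochastic d W" "b \<ge> 0"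
    and "\<And>p. p < d \<Longrightarrow> g p + b * (g p - kernel_app d W g p) = 0" and "p < d"
  shows "g p = 0"
proof -
  have "L2_set g {..<d} \<le> L2_set (\<lambda>_. 0) {..<d}"
    using assms(1-3) by (rule implicit_step_lower_bound)
  then have "L2_set g {..<d} = 0" using L2_set_nonneg[of g "{..<d}"] by (simp add: L2_set_def)
  then show ?thesis using assms(4) by (simp add: L2_set_eq_0_iff)
qed

lemma implicit_step_solvable:
  assumes W: "symm_substochastic d W" and b: "b \<ge> 0"
  shows "\<exists>g. \<forall>p<d. g p + b * (g p - kernel_app d W g p) = z p"
proof -
  \<comment> \<open>The lazy kernel with weight \<open>- b\<close> is the matrix of
    \<open>1 + b (1 - W)\<close>.\<close>
  let ?c = "\<lambda>p q. (1 - (- b)) * of_bool (p = q) + (- b) * W p q"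
  have c: "kernel_app d ?c g p = g p + b * (g p - kernel_app d W g p)" if "p < d" for g p
    unfolding kernel_app_lazy[OF that] by (simp add: algebra_simps)
  have "\<exists>f. \<forall>p<d. kernel_app d ?c f p = z p"
  proof (rule square_system_solvable)
    fix f p assume f: "\<And>p. p < d \<Longrightarrow> kernel_app d ?c f p = 0" and p: "p < d"
    have "f p + b * (f p - kernel_app d W f p) = 0" if "p < d" for p
      using c[OF that, of f] f[OF that] by (rule trans[OF sym])
    then show "f p = 0" by (rule implicit_step_injective[OF W b _ p])
  qed
  then obtain f where f: "\<forall>p<d. kernel_app d ?c f p = z p" ..
  have "f p + b * (f p - kernel_app d W f p) = z p" if "p < d" for p
    using c[OF that, of f] f[rule_format, OF that] by (rule trans[OF sym])
  then show ?thesis by blast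
qed

text \<open>With \<open>B = b c (1 - W)\<close> the solution is
  \<open>- B (1 + B)^(-1) z / b\<close>, and \<open>- B (1 + B)^(-1) = (1 + B)^(-1) - 1\<close> has
  norm at most 2. The bound is free of \<open>c\<close>, although \<open>c\<close> grows like the
  inverse square of the mesh size; this is where uniformity comes from.\<close>

lemma implicit_step_correction:
  assumes W: "symm_substochastic d W" and "b > 0" "c \<ge> 0"
  shows "\<exists>g. (\<forall>p<d. g p + b * c * (g p - kernel_app d W g p) = - (c * (z p - kernel_app d W z p)))
    \<and> L2_set g {..<d} \<le> 2 / b * L2_set z {..<d}"
proof -
  have bc: "b * c \<ge> 0" using assms by simp
  obtain v where v: "\<And>p. p < d \<Longrightarrow> v p + b * c * (v p - kernel_app d W v p) = 1 / b * z p"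
    using implicit_step_solvable[OF W bc, of "\<lambda>p. 1 / b * z p"] by blast
  define g where "g = (\<lambda>p. v p - 1 / b * z p)"
  have "g p + b * c * (g p - kernel_app d W g p) = - (c * (z p - kernel_app d W z p))" if "p < d" for p
  proof -
    have "g p + b * c * (g p - kernel_app d W g p)
       = (v p + b * c * (v p - kernel_app d W v p)) - 1 / b * z p
         - b * (1 / b) * (c * (z p - kernel_app d W z p))"
      unfolding g_def kernel_app_diff kernel_app_cmult by (simp add: algebra_simps)
    then show ?thesis using v[OF that] \<open>b > 0\<close> by simp
  qed
  moreover have "L2_set g {..<d} \<le> 2 / b * L2_set z {..<d}"
  proof -
    have scale: "L2_set (\<lambda>p. 1 / b * z p) {..<d} = 1 / b * L2_set z {..<d}"
      using \<open>b > 0\<close> by (intro L2_set_right_distrib[symmetric]) simp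
    have "L2_set g {..<d} = L2_set (\<lambda>p. v p + (- (1 / b * z p))) {..<d}" by (simp add: g_def)
    also have "\<dots> \<le> L2_set v {..<d} + L2_set (\<lambda>p. - (1 / b * z p)) {..<d}"
      by (rule L2_set_triangle_ineq)
    also have "L2_set (\<lambda>p. - (1 / b * z p)) {..<d} = L2_set (\<lambda>p. 1 / b * z p) {..<d}"
      by (simp add: L2_set_def)
    also have "L2_set v {..<d} \<le> L2_set (\<lambda>p. 1 / b * z p) {..<d}"
      by (rule implicit_step_lower_bound[OF W bc v])
    finally show ?thesis using scale by simp
  qed
  ultimately show ?thesis by blast
qed


section \<open>The discrete Laplacian\<close>

text \<open>Induction on the number of digits: the lowest one is \<open>i mod M\<close>, and digit
  \<open>q\<close> of \<open>i div M\<close> is digit \<open>Suc q\<close> of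
  \<open>i\<close>.\<close>

lemma grid_coord_inject:
  assumes "i < M ^ N" "j < M ^ N" "\<And>q. q < N \<Longrightarrow> grid_coord M q i = grid_coord M q j"
  shows "i = j"
  using assms
proof (induction N arbitrary: i j)
  case (Suc N)
  have "i div M < M ^ N" "j div M < M ^ N"
    using Suc.prems(1,2) by (simp_all add: less_mult_imp_div_less mult.commute)
  moreover have "grid_coord M q (i div M) = grid_coord M q (j div M)" if "q < N" for q
    using Suc.prems(3)[of "Suc q"] that by (simp add: grid_coord_def div_mult2_eq)
  ultimately have "i div M = j div M" by (rule Suc.IH)
  moreover have "i mod M = j mod M" using Suc.prems(3)[of 0] by (simp add: grid_coord_def)
  ultimately show ?case by (metis div_mult_mod_eq)
qed simp

lemma grid_next_right_unique:
  assumes "grid_next N M r i j" "grid_next N M r i k" "j < M ^ N" "k < M ^ N"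
  shows "j = k"
  by (rule grid_coord_inject[OF assms(3,4)]) (use assms(1,2) in \<open>simp add: grid_next_def\<close>)

text \<open>Adding 1 modulo \<open>M\<close> is injective on digits. Uniqueness of successors and
  predecessors is what bounds the row sums of the neighbour average.\<close>

lemma grid_next_left_unique:
  assumes "grid_next N M r i k" "grid_next N M r j k" "i < M ^ N" "j < M ^ N" and "M \<ge> 1"
  shows "i = j"
proof (rule grid_coord_inject[OF assms(3,4)])
  fix q assume q: "q < N"
  have lt: "grid_coord M q i < M" "grid_coord M q j < M"
    using \<open>M \<ge> 1\<close> by (simp_all add: grid_coord_def)
  show "grid_coord M q i = grid_coord M q j"
  proof (cases "q = r")
    case True
    then have "(grid_coord M q i + 1) mod M = (grid_coord M q j + 1) mod M"
      using assms(1,2) q unfolding grid_next_def by metis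
    then show ?thesis using lt by (auto simp: mod_Suc split: if_splits)
  next
    case False
    then show ?thesis using assms(1,2) q unfolding grid_next_def by metis
  qed
qed

text \<open>Coinciding neighbours are counted with multiplicity, as in \<open>neg_laplacian\<close>.
  The divisor \<open>2 * real N\<close> matches the factor \<open>lambda_max N M a / 2\<close> taken
  out of the matrix.\<close>

definition neighbour_mean :: "nat \<Rightarrow> nat \<Rightarrow> nat \<Rightarrow> nat \<Rightarrow> real" where
  "neighbour_mean N M p q =
     (\<Sum>r<N. of_bool (grid_next N M r p q) + of_bool (grid_next N M r q p)) / (2 * real N)"

lemma sum_of_bool_le_1:
  fixes n :: nat
  assumes "\<And>i j. i < n \<Longrightarrow> j < n \<Longrightarrow> P i \<Longrightarrow> P j \<Longrightarrow> i = j"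
  shows "(\<Sum>i<n. of_bool (P i)) \<le> (1 :: real)"
proof -
  have "(\<Sum>i<n. of_bool (P i)) = (\<Sum>i\<in>{i \<in> {..<n}. P i}. 1 :: real)"
    by (subst sum.inter_filter) (auto simp: of_bool_def)
  also have "\<dots> = real (card {i \<in> {..<n}. P i})" by simp
  also have "card {i \<in> {..<n}. P i} \<le> Suc 0"
    using assms by (subst card_le_Suc0_iff_eq) auto
  finally show ?thesis by simp
qed

lemma neighbour_mean_substochastic:
  assumes "M \<ge> 1" "N \<ge> 1"
  shows "symm_substochastic (M ^ N) (neighbour_mean N M)"
  unfolding symm_substochastic_def
proof (intro conjI allI impI)
  fix p q assume "p < M ^ N" "q < M ^ N"
  show "neighbour_mean N M p q = neighbour_mean N M q p"
    by (simp add: neighbour_mean_def add.commute)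
  show "neighbour_mean N M p q \<ge> 0"
    by (simp add: neighbour_mean_def sum_nonneg)
next
  fix p assume p: "p < M ^ N"
  have "(\<Sum>q<M ^ N. neighbour_mean N M p q)
     = (\<Sum>r<N. (\<Sum>q<M ^ N. of_bool (grid_next N M r p q)) + (\<Sum>q<M ^ N. of_bool (grid_next N M r q p)))
       / (2 * real N)"
    unfolding neighbour_mean_def sum_divide_distrib[symmetric]
    by (subst sum.swap) (simp add: sum.distrib)
  also have "\<dots> \<le> (\<Sum>r<N. 1 + 1) / (2 * real N)"
    using assms by (intro divide_right_mono sum_mono add_mono sum_of_bool_le_1)
      (auto dest: grid_next_right_unique grid_next_left_unique)
  also have "\<dots> = 1" using assms by simp
  finally show "(\<Sum>q<M ^ N. neighbour_mean N M p q) \<le> 1" .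
qed

text \<open>Together with the substochasticity of \<open>neighbour_mean\<close>, this is the
  interface between the grid and the estimates; the mesh size survives only in the scalar
  factor.\<close>

lemma neg_laplacian_app:
  assumes "N \<ge> 1" "p < M ^ N"
  shows "kernel_app (M ^ N) (\<lambda>p q. neg_laplacian N M a $$ (p, q)) f p
    = lambda_max N M a / 2 * (f p - kernel_app (M ^ N) (neighbour_mean N M) f p)"
proof -
  let ?c = "lambda_max N M a / 2"
  have "neg_laplacian N M a $$ (p, q) * f q
      = (if p = q then ?c * f q else 0) - ?c * (neighbour_mean N M p q * f q)"
    if "q < M ^ N" for q
  proof -
    define A where "A = a / (mesh_size M)\<^sup>2"
    define S where "S = (\<Sum>r<N. of_bool (grid_next N M r p q) + of_bool (grid_next N M r q p) :: real)"
    have "neg_laplacian N M a $$ (p, q) = A * (2 * real N * of_bool (p = q) - S)"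
      using assms that
      by (simp add: neg_laplacian_def A_def S_def sum_subtractf sum.distrib algebra_simps)
    moreover have "?c = 2 * real N * A" by (simp add: lambda_max_def A_def)
    moreover have "neighbour_mean N M p q = S / (2 * real N)"
      by (simp add: neighbour_mean_def S_def)
    ultimately have eq: "neg_laplacian N M a $$ (p, q) = ?c * (of_bool (p = q) - neighbour_mean N M p q)"
      using assms(1) by (simp add: field_simps)
    show ?thesis unfolding eq by (simp add: algebra_simps)
  qed
  then have "kernel_app (M ^ N) (\<lambda>p q. neg_laplacian N M a $$ (p, q)) f p
      = (\<Sum>q<M ^ N. (if p = q then ?c * f q else 0) - ?c * (neighbour_mean N M p q * f q))"
    unfolding kernel_app_def by (intro sum.cong) auto
  then show ?thesis using assms(2)
    by (simp add: kernel_app_def sum_subtractf sum_distrib_left right_diff_distrib)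
qed


section \<open>Block vectors\<close>

lemma block_index_less: "i < m \<Longrightarrow> p < d \<Longrightarrow> i * d + p < m * (d :: nat)"
proof -
  assume "i < m" "p < d"
  then have "i * d + p < Suc i * d" by simp
  also have "\<dots> \<le> m * d" using \<open>i < m\<close> by (intro mult_right_mono) auto
  finally show ?thesis .
qed

lemma block_index_cases:
  assumes "k < m * (d :: nat)"
  obtains i p where "i < m" "p < d" "k = i * d + p"
proof
  show "k div d < m" using assms by (simp add: less_mult_imp_div_less)
  show "k mod d < d" using assms by (cases "d = 0") auto
  show "k = k div d * d + k mod d" by simp
qed

lemma sum_blocks: "(\<Sum>k<m * d. f k) = (\<Sum>i<m. \<Sum>p<d. f (i * d + p))" for d :: nat
proof -
  have "(\<Sum>k\<in>{i * d..<i * d + d}. f k) = (\<Sum>p<d. f (i * d + p))" for i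
    using sum.shift_bounds_nat_ivl[of f 0 "i * d" d] by (simp add: lessThan_atLeast0 add.commute)
  then show ?thesis by (simp flip: sum.nat_group)
qed

text \<open>The index layout is that of \<open>kron\<close> and \<open>kron_vec\<close>;
  \<open>block d v i\<close> is a function, so that \<open>kernel_app\<close> applies to it
  directly.\<close>

definition block :: "nat \<Rightarrow> real vec \<Rightarrow> nat \<Rightarrow> nat \<Rightarrow> real" where
  "block d v i p = v $ (i * d + p)"

lemma block_kron_mult:
  assumes "A \<in> carrier_mat m m" "D \<in> carrier_mat d d" "Y \<in> carrier_vec (m * d)" "i < m" "p < d"
  shows "block d (kron A D *\<^sub>v Y) i p
    = (\<Sum>j<m. A $$ (i, j) * kernel_app d (\<lambda>p q. D $$ (p, q)) (block d Y j) p)"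
proof -
  have K: "kron A D \<in> carrier_mat (m * d) (m * d)"
    using assms by (auto simp: kron_def)
  have "block d (kron A D *\<^sub>v Y) i p = (\<Sum>k<m * d. kron A D $$ (i * d + p, k) * Y $ k)"
    using K assms block_index_less[OF assms(4,5)]
    by (auto simp: block_def scalar_prod_def lessThan_atLeast0 intro!: sum.cong)
  also have "\<dots> = (\<Sum>j<m. \<Sum>q<d. A $$ (i, j) * (D $$ (p, q) * block d Y j q))"
    unfolding sum_blocks
  proof (intro sum.cong refl)
    fix j q assume "j \<in> {..<m}" "q \<in> {..<d}"
    then show "kron A D $$ (i * d + p, j * d + q) * Y $ (j * d + q)
        = A $$ (i, j) * (D $$ (p, q) * block d Y j q)"
      using assms block_index_less[OF assms(4,5)] block_index_less[of j m q d]
      by (simp add: kron_def block_def)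
  qed
  also have "\<dots> = (\<Sum>j<m. A $$ (i, j) * kernel_app d (\<lambda>p q. D $$ (p, q)) (block d Y j) p)"
    by (simp add: kernel_app_def sum_distrib_left)
  finally show ?thesis .
qed

lemma kron_carrier [simp]:
  "A \<in> carrier_mat m m \<Longrightarrow> D \<in> carrier_mat d d \<Longrightarrow> kron A D \<in> carrier_mat (m * d) (m * d)"
  by (auto simp: kron_def)

lemma kron_ones_carrier [simp]: "y \<in> carrier_vec d \<Longrightarrow> kron_vec (ones_vec m) y \<in> carrier_vec (m * d)"
  by (auto simp: kron_vec_def ones_vec_def)

lemma block_kron_ones:
  assumes "y \<in> carrier_vec d" "i < m" "p < d"
  shows "block d (kron_vec (ones_vec m) y) i p = y $ p"
  using assms block_index_less[OF assms(2,3)]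
  by (simp add: block_def kron_vec_def ones_vec_def less_mult_imp_div_less)

lemma block_eq_iff:
  assumes "u \<in> carrier_vec (m * d)" "v \<in> carrier_vec (m * d)"
  shows "u = v \<longleftrightarrow> (\<forall>i<m. \<forall>p<d. block d u i p = block d v i p)"
proof
  assume *: "\<forall>i<m. \<forall>p<d. block d u i p = block d v i p"
  show "u = v"
  proof (rule eq_vecI)
    fix k assume "k < dim_vec v"
    then have "k < m * d" using assms by simp
    then obtain i p where "i < m" "p < d" "k = i * d + p" by (rule block_index_cases)
    then show "u $ k = v $ k" using * by (simp add: block_def)
  qed (use assms in simp)
qed simp

lemma block_diff:
  assumes "u \<in> carrier_vec (m * d)" "v \<in> carrier_vec (m * d)" "i < m" "p < d"
  shows "block d (u - v) i p = block d u i p - block d v i p"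
  using assms block_index_less[OF assms(3,4)] by (simp add: block_def)

lemma block_add:
  assumes "u \<in> carrier_vec (m * d)" "v \<in> carrier_vec (m * d)" "i < m" "p < d"
  shows "block d (u + v) i p = block d u i p + block d v i p"
  using assms block_index_less[OF assms(3,4)] by (simp add: block_def)

lemma block_smult:
  assumes "u \<in> carrier_vec (m * d)" "i < m" "p < d"
  shows "block d (c \<cdot>\<^sub>v u) i p = c * block d u i p"
  using assms block_index_less[OF assms(2,3)] by (simp add: block_def)

section \<open>Norms of block vectors\<close>

lemma norm2_blocks:
  assumes "v \<in> carrier_vec (m * d)"
  shows "norm2 v = L2_set (\<lambda>i. L2_set (block d v i) {..<d}) {..<m}"
proof -
  have "v \<bullet> v = (\<Sum>k<m * d. (v $ k)\<^sup>2)"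
    using assms by (simp add: scalar_prod_def lessThan_atLeast0 power2_eq_square)
  also have "\<dots> = (\<Sum>i<m. (L2_set (block d v i) {..<d})\<^sup>2)"
    by (simp add: sum_blocks block_def L2_set_power2)
  finally show ?thesis by (simp add: norm2_def L2_set_def)
qed

lemma norm2_le_sum_blocks:
  assumes "v \<in> carrier_vec (m * d)"
  shows "norm2 v \<le> (\<Sum>i<m. L2_set (block d v i) {..<d})"
  unfolding norm2_blocks[OF assms] by (rule L2_set_le_sum) simp

text \<open>The crude factor \<open>m\<close> is harmless: the final constant may depend on the
  number of stages, only not on \<open>d\<close>.\<close>

lemma sum_blocks_le_norm2:
  assumes "v \<in> carrier_vec (m * d)"
  shows "(\<Sum>i<m. L2_set (block d v i) {..<d}) \<le> real m * norm2 v"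
proof -
  have "L2_set (block d v i) {..<d} \<le> norm2 v" if "i < m" for i
    unfolding norm2_blocks[OF assms] using that by (intro member_le_L2_set) auto
  then have "(\<Sum>i<m. L2_set (block d v i) {..<d}) \<le> (\<Sum>i<m. norm2 v)" by (intro sum_mono) auto
  then show ?thesis by simp
qed

lemma L2_set_sum:
  assumes "finite J"
  shows "L2_set (\<lambda>p. \<Sum>j\<in>J. f j p) I \<le> (\<Sum>j\<in>J. L2_set (f j) I)"
  using assms
proof (induction J rule: finite_induct)
  case (insert j J)
  have "L2_set (\<lambda>p. \<Sum>j\<in>insert j J. f j p) I = L2_set (\<lambda>p. f j p + (\<Sum>j\<in>J. f j p)) I"
    using insert by simp
  also have "\<dots> \<le> L2_set (f j) I + L2_set (\<lambda>p. \<Sum>j\<in>J. f j p) I"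
    by (rule L2_set_triangle_ineq)
  finally show ?case using insert by simp
qed (simp add: L2_set_def)

lemma L2_set_cmult: "L2_set (\<lambda>p. c * f p) I = \<bar>c\<bar> * L2_set f I"
proof -
  have "L2_set (\<lambda>p. c * f p) I = L2_set (\<lambda>p. \<bar>c\<bar> * f p) I"
    by (simp add: L2_set_def power_mult_distrib)
  then show ?thesis by (simp add: L2_set_right_distrib)
qed


section \<open>The inner iteration\<close>

lemma rkc_inner_carrier:
  assumes "x \<in> carrier_vec n" "\<And>z. z \<in> carrier_vec n \<Longrightarrow> G z \<in> carrier_vec n"
  shows "rkc_inner G \<eta> s x j \<in> carrier_vec n"
  using assms by (induction j rule: induct_nat_012) auto

text \<open>\<open>GX\<close> says that on stage \<open>i\<close> the residual vanishes at
  \<open>b\<close> and acts on the error through \<open>X\<close>. The rescaled errors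
  \<open>T j * (x j - b)\<close> then obey the Chebyshev recurrence for \<open>X\<close>, so their
  norm does not grow, and undoing the scaling at \<open>j = s\<close> leaves
  \<open>1 / T s\<close>.\<close>

lemma rkc_inner_contraction:
  fixes \<eta> :: real
  defines "\<omega> \<equiv> \<lambda>s. rkc_omega0 \<eta> s"
  assumes x: "x \<in> carrier_vec (m * d)" and G: "\<And>z. z \<in> carrier_vec (m * d) \<Longrightarrow> G z \<in> carrier_vec (m * d)"
    and i: "i < m" and s: "s \<ge> 1" and \<eta>: "\<eta> > 0"
    and X: "symm_substochastic d X"
    and GX: "\<And>z p. z \<in> carrier_vec (m * d) \<Longrightarrow> p < d \<Longrightarrow> (\<omega> s - 1) * block d (G z) i p
      = kernel_app d X (\<lambda>q. block d z i q - b q) p - \<omega> s * (block d z i p - b p)"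
  shows "L2_set (\<lambda>p. block d (rkc_inner G \<eta> s x s) i p - b p) {..<d}
    \<le> rkc_alpha \<eta> s * L2_set (\<lambda>p. block d x i p - b p) {..<d}"
proof -
  define w0 where "w0 = \<omega> s"
  have w0: "w0 > 1" using s \<eta> by (simp add: w0_def \<omega>_def rkc_omega0_def)
  define T where "T j = poly (chebyshev j) w0" for j
  have T1: "T j \<ge> 1" for j unfolding T_def using w0 by (intro chebyshev_ge_1) simp
  then have T0: "T j > 0" "T j \<noteq> 0" for j using T1[of j] by linarith+
  have rec: "T (Suc (Suc j)) = 2 * w0 * T (Suc j) - T j" for j
    by (simp add: T_def poly_chebyshev_Suc_Suc)
  \<comment> \<open>The cancellation needs \<open>rkc_omega1\<close> nonzero, which rests on the
    positive derivative, since division by 0 yields 0.\<close>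
  have h: "rkc_omega1 \<eta> s * rkc_h \<eta> s = w0 - 1"
  proof -
    have "rkc_omega1 \<eta> s \<noteq> 0"
      using T0(2)[of s] pderiv_chebyshev_pos[of w0 s] s w0
      by (simp add: rkc_omega1_def T_def w0_def \<omega>_def)
    then show ?thesis by (simp add: rkc_h_def rkc_ell_def w0_def \<omega>_def)
  qed
  \<comment> \<open>The factor \<open>T j\<close> clears the denominators of \<open>rkc_mu\<close>
    and \<open>rkc_nu\<close>.\<close>
  define t where "t j p = T j * (block d (rkc_inner G \<eta> s x j) i p - b p)" for j p
  have car: "rkc_inner G \<eta> s x j \<in> carrier_vec (m * d)" for j
    by (rule rkc_inner_carrier[OF x G])
  have Kt: "kernel_app d X (t j) p
      = T j * kernel_app d X (\<lambda>q. block d (rkc_inner G \<eta> s x j) i q - b q) p" for j p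
    unfolding t_def[abs_def] by (rule kernel_app_cmult)
  have step0: "t (Suc 0) p = kernel_app d X (t 0) p" if p: "p < d" for p
  proof -
    have "block d (rkc_inner G \<eta> s x (Suc 0)) i p
        = block d x i p + rkc_h \<eta> s * rkc_mu \<eta> s 1 * block d (G x) i p"
      using x G i p by (simp add: block_add[where m = m] block_smult[where m = m])
    also have "rkc_h \<eta> s * rkc_mu \<eta> s 1 = (w0 - 1) / w0"
      by (simp add: rkc_mu_def h[symmetric] w0_def[symmetric] \<omega>_def[symmetric])
    finally have "t (Suc 0) p = w0 * (block d x i p - b p) + (w0 - 1) * block d (G x) i p"
      using w0 by (simp add: t_def T_def chebyshev_1 field_simps)
    then show ?thesis
      using GX[OF x p] by (simp add: Kt T_def chebyshev_0 w0_def)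
  qed
  have step: "t (Suc (Suc j)) p = 2 * kernel_app d X (t (Suc j)) p - t j p" if p: "p < d" for j p
  proof -
    define z1 z0 where "z1 = rkc_inner G \<eta> s x (Suc j)" and "z0 = rkc_inner G \<eta> s x j"
    define B1 B0 B where "B1 = block d z1 i p" and "B0 = block d z0 i p" and "B = block d (G z1) i p"
    let ?mu = "rkc_mu \<eta> s (Suc (Suc j))" and ?nu = "rkc_nu \<eta> s (Suc (Suc j))"
    have z: "z1 \<in> carrier_vec (m * d)" "z0 \<in> carrier_vec (m * d)" by (simp_all add: z1_def z0_def car)
    have eq: "block d (rkc_inner G \<eta> s x (Suc (Suc j))) i p = ?mu * rkc_h \<eta> s * B + ?nu * B1 - (?nu - 1) * B0"
      using z G i p by (simp add: z1_def[symmetric] z0_def[symmetric] B1_def B0_def B_def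
          block_add[where m = m] block_diff[where m = m] block_smult[where m = m])
    have nu: "T (Suc (Suc j)) * ?nu = 2 * w0 * T (Suc j)"
      using T0(2)[of "Suc (Suc j)"] by (simp add: rkc_nu_def T_def w0_def \<omega>_def)
    have "T (Suc (Suc j)) * (?mu * rkc_h \<eta> s) = 2 * T (Suc j) * (rkc_omega1 \<eta> s * rkc_h \<eta> s)"
      using T0(2)[of "Suc (Suc j)"] by (simp add: rkc_mu_def T_def w0_def \<omega>_def)
    then have mu: "T (Suc (Suc j)) * (?mu * rkc_h \<eta> s) = 2 * T (Suc j) * (w0 - 1)"
      by (simp only: h)
    have "T (Suc (Suc j)) * block d (rkc_inner G \<eta> s x (Suc (Suc j))) i p
      = T (Suc (Suc j)) * (?mu * rkc_h \<eta> s) * B + T (Suc (Suc j)) * ?nu * B1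
        - (T (Suc (Suc j)) * ?nu - T (Suc (Suc j))) * B0"
      unfolding eq by (simp add: algebra_simps)
    then have "T (Suc (Suc j)) * block d (rkc_inner G \<eta> s x (Suc (Suc j))) i p
      = 2 * T (Suc j) * (w0 - 1) * B + 2 * w0 * T (Suc j) * B1 - (2 * w0 * T (Suc j) - T (Suc (Suc j))) * B0"
      unfolding mu nu .
    \<comment> \<open>The recurrence at \<open>w0\<close> turns
      \<open>2 * w0 * T (Suc j) - T (Suc (Suc j))\<close> into \<open>T j\<close>, and the same
      identity balances the shifts by \<open>b\<close>.\<close>
    then have "t (Suc (Suc j)) p = 2 * T (Suc j) * ((w0 - 1) * B + w0 * (B1 - b p)) - T j * (B0 - b p)"
      by (simp add: t_def right_diff_distrib[of "T (Suc (Suc j))"]) (simp add: rec algebra_simps)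
    also have "(w0 - 1) * B + w0 * (B1 - b p) = kernel_app d X (\<lambda>q. block d z1 i q - b q) p"
      using GX[OF z(1) p] by (simp add: B_def B1_def w0_def)
    finally show ?thesis by (simp add: Kt z1_def t_def B0_def z0_def)
  qed
  have "L2_set (t s) {..<d} \<le> L2_set (t 0) {..<d}"
    by (rule chebyshev_recurrence_contraction[OF X step0 step])
  moreover have "L2_set (t s) {..<d} = T s * L2_set (\<lambda>p. block d (rkc_inner G \<eta> s x s) i p - b p) {..<d}"
    unfolding t_def[abs_def] L2_set_cmult using T0(1)[of s] by simp
  moreover have "t 0 = (\<lambda>p. block d x i p - b p)"
    by (simp add: t_def[abs_def] T_def chebyshev_0)
  ultimately show ?thesis
    using T0(1)[of s] by (simp add: rkc_alpha_def T_def w0_def \<omega>_def field_simps)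
qed


section \<open>One step of the partitioned iteration\<close>

lemma sdirk_solution_block_iff:
  assumes A: "A \<in> carrier_mat m m" and D: "D \<in> carrier_mat d d"
    and y: "y \<in> carrier_vec d" and Y: "Y \<in> carrier_vec (m * d)"
  shows "sdirk_solution m A D dt y Y \<longleftrightarrow> (\<forall>i<m. \<forall>p<d. block d Y i p
    = y $ p - dt * (\<Sum>j<m. A $$ (i, j) * kernel_app d (\<lambda>p q. D $$ (p, q)) (block d Y j) p))"
proof -
  have K: "kron A D *\<^sub>v Y \<in> carrier_vec (m * d)" using A D Y by (intro mult_mat_vec_carrier) auto
  then have "kron_vec (ones_vec m) y - dt \<cdot>\<^sub>v (kron A D *\<^sub>v Y) \<in> carrier_vec (m * d)"
    using y by auto
  from block_eq_iff[OF Y this] show ?thesis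
    using y Y K unfolding sdirk_solution_def
    by (simp add: block_diff[where m = m] block_smult[where m = m] block_kron_ones block_kron_mult[OF A D Y])
qed

section \<open>Unique solvability of the stage equations\<close>

text \<open>Forward substitution: earlier stages vanish by induction, later ones have coefficient 0,
  and what remains on stage \<open>i\<close> is an injective implicit step with weight
  \<open>dt * \<gamma> * c\<close>.\<close>

lemma sdirk_stages_injective:
  assumes W: "symm_substochastic d W" and c: "c \<ge> 0" and "dt \<ge> 0" and A: "sdirk_matrix m \<gamma> A"
    and f: "\<And>i p. i < m \<Longrightarrow> p < d \<Longrightarrow>
      f i p + dt * (\<Sum>j<m. A $$ (i, j) * (c * (f j p - kernel_app d W (f j) p))) = 0"
  shows "i < m \<Longrightarrow> p < d \<Longrightarrow> f i p = 0"
proof (induction i arbitrary: p rule: less_induct)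
  case (less i)
  have "f i p + dt * \<gamma> * c * (f i p - kernel_app d W (f i) p) = 0" if p: "p < d" for p
  proof -
    have "A $$ (i, j) * (c * (f j p - kernel_app d W (f j) p)) = 0" if "j < m" "j \<noteq> i" for j
    proof (cases "j < i")
      case True
      then have "f j q = 0" if "q < d" for q using less.IH[of j q] less.prems(1) that by simp
      then have "f j p = 0" "kernel_app d W (f j) p = 0" using p by (auto simp: kernel_app_def)
      then show ?thesis by simp
    next
      case False
      then show ?thesis using that less.prems(1) A by (simp add: sdirk_matrix_def)
    qed
    then have "(\<Sum>j<m. A $$ (i, j) * (c * (f j p - kernel_app d W (f j) p)))
        = (\<Sum>j\<in>{i}. A $$ (i, j) * (c * (f j p - kernel_app d W (f j) p)))"
      using less.prems(1) by (intro sum.mono_neutral_right) auto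
    also have "\<dots> = \<gamma> * (c * (f i p - kernel_app d W (f i) p))"
      using less.prems(1) A by (simp add: sdirk_matrix_def)
    finally show ?thesis using f[OF less.prems(1) p] by (simp add: mult.assoc)
  qed
  moreover have "dt * \<gamma> * c \<ge> 0" using assms by (simp add: sdirk_matrix_def)
  ultimately show ?case using implicit_step_injective[OF W] less.prems(2) by blast
qed

lemma sdirk_solution_ex1:
  assumes W: "symm_substochastic d W" and c: "c \<ge> 0" and dt: "dt \<ge> 0" and A: "sdirk_matrix m \<gamma> A"
    and D: "D \<in> carrier_mat d d"
    and Dapp: "\<And>f p. p < d \<Longrightarrow>
      kernel_app d (\<lambda>p q. D $$ (p, q)) f p = c * (f p - kernel_app d W f p)"
    and y: "y \<in> carrier_vec d"
  shows "\<exists>!Y. sdirk_solution m A D dt y Y"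
proof (rule ex_ex1I)
  have A': "A \<in> carrier_mat m m" using A by (simp add: sdirk_matrix_def)
  note iff = sdirk_solution_block_iff[OF A' D y]
  \<comment> \<open>The matrix of the whole stage system, identity plus \<open>dt\<close> times
    \<open>kron A D\<close>, on flattened indices.\<close>
  let ?K = "\<lambda>k l. of_bool (k = l) + dt * kron A D $$ (k, l)"
  have K: "kernel_app (m * d) ?K f (i * d + p) = f (i * d + p)
      + dt * (\<Sum>j<m. A $$ (i, j) * (c * (f (j * d + p) - kernel_app d W (\<lambda>q. f (j * d + q)) p)))"
    if ip: "i < m" "p < d" for f i p
  proof -
    let ?k = "i * d + p"
    have k: "?k < m * d" using ip by (rule block_index_less)
    have "kernel_app (m * d) ?K f ?k
        = (\<Sum>l<m * d. (if ?k = l then f l else 0) + dt * (kron A D $$ (?k, l) * f l))"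
      unfolding kernel_app_def by (intro sum.cong) (auto simp: distrib_right)
    also have "\<dots> = f ?k + dt * (\<Sum>l<m * d. kron A D $$ (?k, l) * f l)"
      using k by (simp add: sum.distrib sum_distrib_left)
    also have "(\<Sum>l<m * d. kron A D $$ (?k, l) * f l) = block d (kron A D *\<^sub>v vec (m * d) f) i p"
      using k kron_carrier[OF A' D] by (auto simp: block_def scalar_prod_def lessThan_atLeast0 intro!: sum.cong)
    also have "\<dots> = (\<Sum>j<m. A $$ (i, j) * (c * (f (j * d + p) - kernel_app d W (\<lambda>q. f (j * d + q)) p)))"
      unfolding block_kron_mult[OF A' D vec_carrier ip] Dapp[OF ip(2)]
    proof (intro sum.cong refl)
      fix j assume "j \<in> {..<m}"
      then have "block d (vec (m * d) f) j q = f (j * d + q)" if "q < d" for q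
        using block_index_less[of j m q d] that by (simp add: block_def)
      then show "A $$ (i, j) * (c * (block d (vec (m * d) f) j p - kernel_app d W (block d (vec (m * d) f) j) p))
          = A $$ (i, j) * (c * (f (j * d + p) - kernel_app d W (\<lambda>q. f (j * d + q)) p))"
        using ip(2) by (simp cong: kernel_app_cong)
    qed
    finally show ?thesis .
  qed
  show "\<exists>Y. sdirk_solution m A D dt y Y"
  proof -
    \<comment> \<open>The right-hand side \<open>y $ (k mod d)\<close> is entry \<open>k\<close> of
      \<open>kron_vec (ones_vec m) y\<close>.\<close>
    have "\<exists>f. \<forall>k<m * d. kernel_app (m * d) ?K f k = y $ (k mod d)"
    proof (rule square_system_solvable)
      fix f k assume f: "\<And>k. k < m * d \<Longrightarrow> kernel_app (m * d) ?K f k = 0" and "k < m * d"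
      from \<open>k < m * d\<close> obtain i p where ip: "i < m" "p < d" "k = i * d + p" by (rule block_index_cases)
      have "f (i * d + p) = 0"
        by (rule sdirk_stages_injective[OF W c dt A, where f = "\<lambda>i p. f (i * d + p)"])
          (use ip f block_index_less in \<open>simp_all flip: K\<close>)
      then show "f k = 0" using ip by simp
    qed
    then obtain f where f: "\<And>k. k < m * d \<Longrightarrow> kernel_app (m * d) ?K f k = y $ (k mod d)" by blast
    have "block d (vec (m * d) f) i p = y $ p - dt * (\<Sum>j<m. A $$ (i, j) *
        kernel_app d (\<lambda>p q. D $$ (p, q)) (block d (vec (m * d) f) j) p)" if ip: "i < m" "p < d" for i p
    proof -
      have b: "block d (vec (m * d) f) j q = f (j * d + q)" if "j < m" "q < d" for j q
        using block_index_less[OF that] that by (simp add: block_def)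
      have "y $ p = f (i * d + p)
        + dt * (\<Sum>j<m. A $$ (i, j) * (c * (f (j * d + p) - kernel_app d W (\<lambda>q. f (j * d + q)) p)))"
        using f[OF block_index_less[OF ip]] ip by (simp add: K)
      also have "(\<Sum>j<m. A $$ (i, j) * (c * (f (j * d + p) - kernel_app d W (\<lambda>q. f (j * d + q)) p)))
        = (\<Sum>j<m. A $$ (i, j) * kernel_app d (\<lambda>p q. D $$ (p, q)) (block d (vec (m * d) f) j) p)"
        using ip by (intro sum.cong) (auto simp: Dapp b cong: kernel_app_cong)
      finally show ?thesis using ip by (simp add: b)
    qed
    then have "sdirk_solution m A D dt y (vec (m * d) f)" by (subst iff) auto
    then show ?thesis ..
  qed
  fix Y Z assume YZ: "sdirk_solution m A D dt y Y" "sdirk_solution m A D dt y Z"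
  then have car: "Y \<in> carrier_vec (m * d)" "Z \<in> carrier_vec (m * d)"
    using y by (auto simp: sdirk_solution_def)
  define f where "f = (\<lambda>i p. block d Y i p - block d Z i p)"
  have "f i p = 0" if "i < m" "p < d" for i p
  proof (rule sdirk_stages_injective[OF W c dt A _ that])
    fix i p assume ip: "i < m" "p < d"
    then have "f i p = - dt * (\<Sum>j<m. A $$ (i, j) * (c * (block d Y j p - kernel_app d W (block d Y j) p)))
        + dt * (\<Sum>j<m. A $$ (i, j) * (c * (block d Z j p - kernel_app d W (block d Z j) p)))"
      using YZ iff[OF car(1)] iff[OF car(2)] by (simp add: f_def Dapp)
    also have "\<dots> = - dt * (\<Sum>j<m. A $$ (i, j) * (c * (f j p - kernel_app d W (f j) p)))"
      by (simp add: f_def kernel_app_diff algebra_simps sum.distrib sum_subtractf sum_negf sum_distrib_left)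
    finally show "f i p + dt * (\<Sum>j<m. A $$ (i, j) * (c * (f j p - kernel_app d W (f j) p))) = 0"
      by simp
  qed
  then show "Y = Z" unfolding block_eq_iff[OF car] by (simp add: f_def)
qed

section \<open>Error propagation of one outer step\<close>

lemma prkc_G_carrier:
  assumes "A \<in> carrier_mat m m" "D \<in> carrier_mat d d" "y \<in> carrier_vec d"
    "x \<in> carrier_vec (m * d)" "z \<in> carrier_vec (m * d)"
  shows "prkc_G_D m \<gamma> D dt y z + prkc_G_A m \<gamma> A D dt x \<in> carrier_vec (m * d)"
proof -
  have "kron (1\<^sub>m m) D *\<^sub>v z \<in> carrier_vec (m * d)"
    "kron (A - \<gamma> \<cdot>\<^sub>m 1\<^sub>m m) D *\<^sub>v x \<in> carrier_vec (m * d)"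
    using assms by (auto intro!: mult_mat_vec_carrier kron_carrier)
  then show ?thesis using assms unfolding prkc_G_D_def prkc_G_A_def by auto
qed

lemma prkc_step_carrier:
  assumes "A \<in> carrier_mat m m" "D \<in> carrier_mat d d" "y \<in> carrier_vec d" "x \<in> carrier_vec (m * d)"
  shows "prkc_step m \<gamma> A D dt \<eta> s y x \<in> carrier_vec (m * d)"
  unfolding prkc_step_def by (intro rkc_inner_carrier prkc_G_carrier assms)

lemma block_prkc_G:
  assumes A: "A \<in> carrier_mat m m" and D: "D \<in> carrier_mat d d" and y: "y \<in> carrier_vec d"
    and x: "x \<in> carrier_vec (m * d)" and z: "z \<in> carrier_vec (m * d)" and ip: "i < m" "p < d"
  shows "block d (prkc_G_D m \<gamma> D dt y z + prkc_G_A m \<gamma> A D dt x) i p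
    = y $ p - block d z i p - dt * \<gamma> * kernel_app d (\<lambda>p q. D $$ (p, q)) (block d z i) p
      - dt * (\<Sum>j<m. (A $$ (i, j) - \<gamma> * of_bool (i = j)) * kernel_app d (\<lambda>p q. D $$ (p, q)) (block d x j) p)"
proof -
  let ?D = "\<lambda>f. kernel_app d (\<lambda>p q. D $$ (p, q)) f p"
  have S: "A - \<gamma> \<cdot>\<^sub>m 1\<^sub>m m \<in> carrier_mat m m" using A by auto
  have car: "kron (1\<^sub>m m) D *\<^sub>v z \<in> carrier_vec (m * d)"
    "kron (A - \<gamma> \<cdot>\<^sub>m 1\<^sub>m m) D *\<^sub>v x \<in> carrier_vec (m * d)"
    using D x z S by (auto intro!: mult_mat_vec_carrier kron_carrier)
  have "block d (kron (1\<^sub>m m) D *\<^sub>v z) i p = (\<Sum>j<m. if i = j then ?D (block d z j) else 0)"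
    unfolding block_kron_mult[OF one_carrier_mat D z ip] using ip by (intro sum.cong) auto
  also have "\<dots> = ?D (block d z i)" using ip by simp
  finally have 1: "block d (kron (1\<^sub>m m) D *\<^sub>v z) i p = ?D (block d z i)" .
  have 2: "block d (kron (A - \<gamma> \<cdot>\<^sub>m 1\<^sub>m m) D *\<^sub>v x) i p
      = (\<Sum>j<m. (A $$ (i, j) - \<gamma> * of_bool (i = j)) * ?D (block d x j))"
    unfolding block_kron_mult[OF S D x ip] using ip A by (intro sum.cong) auto
  have c: "kron_vec (ones_vec m) y \<in> carrier_vec (m * d)" using y by simp
  show ?thesis
    unfolding prkc_G_D_def prkc_G_A_def
    using car c z y ip
    by (simp add: block_add[where m = m] block_diff[where m = m] block_smult[where m = m] block_kron_ones 1 2)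
qed

lemma rkc_alpha_bounds:
  assumes "\<eta> > 0" "s \<ge> 1"
  shows "0 < rkc_alpha \<eta> s" "rkc_alpha \<eta> s < 1"
proof -
  have "rkc_omega0 \<eta> s > 1" using assms by (simp add: rkc_omega0_def)
  then have "poly (chebyshev s) (rkc_omega0 \<eta> s) > 1" using assms(2) by (rule chebyshev_gt_1)
  then show "0 < rkc_alpha \<eta> s" "rkc_alpha \<eta> s < 1" by (simp_all add: rkc_alpha_def)
qed

text \<open>The inner iteration on the stage \<open>i\<close> contracts towards \<open>Y + g\<close>, where the defect \<open>g\<close>
  comes from the frozen coupling \<open>G_A\<close> and involves only the errors of the stages before \<open>i\<close>.\<close>

lemma prkc_step_error:
  assumes W: "symm_substochastic d W" and c: "c \<ge> 0" and dt: "dt > 0" and A: "sdirk_matrix m \<gamma> A"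
    and D: "D \<in> carrier_mat d d"
    and Dapp: "\<And>f p. p < d \<Longrightarrow>
      kernel_app d (\<lambda>p q. D $$ (p, q)) f p = c * (f p - kernel_app d W f p)"
    and y: "y \<in> carrier_vec d" and Y: "sdirk_solution m A D dt y Y" and x: "x \<in> carrier_vec (m * d)"
    and \<eta>: "\<eta> > 0" and s: "s \<ge> 1" and stable: "\<gamma> * dt * c * \<eta> \<le> (real s)\<^sup>2" and i: "i < m"
  shows "L2_set (block d (prkc_step m \<gamma> A D dt \<eta> s y x - Y) i) {..<d}
    \<le> rkc_alpha \<eta> s * L2_set (block d (x - Y) i) {..<d}
      + 4 / \<gamma> * (\<Sum>j<i. \<bar>A $$ (i, j)\<bar> * L2_set (block d (x - Y) j) {..<d})"
proof -
  have A': "A \<in> carrier_mat m m" and \<gamma>: "\<gamma> > 0" using A by (simp_all add: sdirk_matrix_def)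
  have Yc: "Y \<in> carrier_vec (m * d)" using Y y by (simp add: sdirk_solution_def)
  note Yb = sdirk_solution_block_iff[OF A' D y Yc, THEN iffD1, OF Y, rule_format, OF i]
  let ?S = "\<lambda>j. A $$ (i, j) - \<gamma> * of_bool (i = j)"
  let ?x' = "prkc_step m \<gamma> A D dt \<eta> s y x"
  define e where "e j p = block d x j p - block d Y j p" for j p
  have e: "block d (x - Y) j p = e j p" if "j < m" "p < d" for j p
    using that x Yc by (simp add: block_diff[where m = m] e_def)
  define b z where "b = dt * \<gamma>" and "z p = dt * (\<Sum>j<m. ?S j * e j p)" for p
  have b: "b > 0" using dt \<gamma> by (simp add: b_def)
  \<comment> \<open>This \<open>g\<close> is chosen so that the residual with frozen coupling
    vanishes on stage \<open>i\<close> at \<open>Y + g\<close>.\<close>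
  obtain g where g: "\<And>p. p < d \<Longrightarrow> g p + b * c * (g p - kernel_app d W g p) = - (c * (z p - kernel_app d W z p))"
    and gz: "L2_set g {..<d} \<le> 2 / b * L2_set z {..<d}"
    using implicit_step_correction[OF W b c] by blast
  \<comment> \<open>The weight for which \<open>\<omega> - (\<omega> - 1) (1 + b c (1 - W))\<close>
    equals \<open>(1 - t) + t W\<close>, where \<open>\<omega>\<close> is \<open>rkc_omega0\<close>;
    \<open>stable\<close> is exactly \<open>t \<le> 1\<close>.\<close>
  define t where "t = (rkc_omega0 \<eta> s - 1) * b * c"
  have t: "t = \<gamma> * dt * c * \<eta> / (real s)\<^sup>2" by (simp add: t_def rkc_omega0_def b_def)
  have "0 \<le> t" "t \<le> 1"
    using stable s c dt \<gamma> \<eta> unfolding t by (simp_all add: divide_le_eq)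
  define X where "X = (\<lambda>p q. (1 - t) * of_bool (p = q) + t * W p q)"
  have X: "symm_substochastic d X"
    unfolding X_def using W \<open>0 \<le> t\<close> \<open>t \<le> 1\<close> by (rule symm_substochastic_lazy)
  have contr: "L2_set (\<lambda>p. block d ?x' i p - (block d Y i p + g p)) {..<d}
      \<le> rkc_alpha \<eta> s * L2_set (\<lambda>p. block d x i p - (block d Y i p + g p)) {..<d}"
    unfolding prkc_step_def
  proof (rule rkc_inner_contraction[OF x _ i s \<eta> X])
    fix v :: "real vec" assume v: "v \<in> carrier_vec (m * d)"
    show "prkc_G_D m \<gamma> D dt y v + prkc_G_A m \<gamma> A D dt x \<in> carrier_vec (m * d)"
      by (rule prkc_G_carrier[OF A' D y x v])
    fix p assume p: "p < d"
    let ?G = "block d (prkc_G_D m \<gamma> D dt y v + prkc_G_A m \<gamma> A D dt x) i p"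
    let ?W = "\<lambda>f. kernel_app d W f p"
    define w where "w q = block d v i q - (block d Y i q + g q)" for q
    have split: "(\<Sum>j<m. A $$ (i, j) * F j) = (\<Sum>j<m. ?S j * F j) + \<gamma> * F i" for F :: "nat \<Rightarrow> real"
    proof -
      have "(\<Sum>j<m. A $$ (i, j) * F j) = (\<Sum>j<m. ?S j * F j + (if i = j then \<gamma> * F j else 0))"
        by (intro sum.cong) (auto simp: algebra_simps)
      then show ?thesis using i by (simp add: sum.distrib)
    qed
    have Wz: "?W z = dt * (\<Sum>j<m. ?S j * ?W (e j))"
    proof -
      have "?W (\<lambda>q. \<Sum>j\<in>J. ?S j * e j q) = (\<Sum>j\<in>J. ?S j * ?W (e j))" if "finite J" for J
        using that
        by (induction J rule: finite_induct) (simp_all add: kernel_app_add kernel_app_cmult, simp add: kernel_app_def)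
      then show ?thesis unfolding z_def[abs_def] kernel_app_cmult by simp
    qed
    have We: "?W (e j) = ?W (block d x j) - ?W (block d Y j)" for j
      unfolding e_def[abs_def] by (rule kernel_app_diff)
    define Sx SY where "Sx = dt * (\<Sum>j<m. ?S j * (c * (block d x j p - ?W (block d x j))))"
      and "SY = dt * (\<Sum>j<m. ?S j * (c * (block d Y j p - ?W (block d Y j))))"
    have "?G = y $ p - block d v i p - b * (c * (block d v i p - ?W (block d v i)))
        - Sx"
      by (simp add: block_prkc_G[OF A' D y x v i p] Dapp[OF p] b_def Sx_def)
    moreover have "block d Y i p = y $ p - SY
        - b * (c * (block d Y i p - ?W (block d Y i)))"
      using Yb[OF p] unfolding Dapp[OF p] split by (simp add: SY_def b_def distrib_left mult_ac)
    moreover have "c * (z p - ?W z) = Sx - SY"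
      unfolding Sx_def SY_def Wz We z_def e_def right_diff_distrib[of c] sum_distrib_left sum_subtractf[symmetric]
      by (intro sum.cong refl) (simp add: algebra_simps)
    moreover have Ww: "?W w = ?W (block d v i) - (?W (block d Y i) + ?W g)"
      unfolding w_def[abs_def] kernel_app_diff kernel_app_add ..
    ultimately have G: "?G = - (w p + b * c * (w p - ?W w))"
      using g[OF p] unfolding Ww unfolding w_def by (simp only: algebra_simps)
    have "(rkc_omega0 \<eta> s - 1) * ?G = (1 - t) * w p + t * ?W w - rkc_omega0 \<eta> s * w p"
      unfolding G by (simp add: t_def algebra_simps)
    then show "(rkc_omega0 \<eta> s - 1) * ?G = kernel_app d X (\<lambda>q. block d v i q - (block d Y i q + g q)) p
        - rkc_omega0 \<eta> s * (block d v i p - (block d Y i p + g p))"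
      unfolding X_def kernel_app_lazy[OF p] by (simp only: w_def[symmetric])
  qed
  define \<alpha> where "\<alpha> = rkc_alpha \<eta> s"
  have \<alpha>: "0 \<le> \<alpha>" "\<alpha> \<le> 1" using rkc_alpha_bounds[OF \<eta> s] by (simp_all add: \<alpha>_def)
  have x': "?x' \<in> carrier_vec (m * d)" by (rule prkc_step_carrier[OF A' D y x])
  have "L2_set (block d (?x' - Y) i) {..<d} = L2_set (\<lambda>p. (block d ?x' i p - (block d Y i p + g p)) + g p) {..<d}"
    using x' Yc i by (intro L2_set_cong) (auto simp: block_diff[where m = m])
  also have "\<dots> \<le> L2_set (\<lambda>p. block d ?x' i p - (block d Y i p + g p)) {..<d} + L2_set g {..<d}"
    by (rule L2_set_triangle_ineq)
  also have "\<dots> \<le> \<alpha> * L2_set (\<lambda>p. block d x i p - (block d Y i p + g p)) {..<d} + L2_set g {..<d}"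
    using contr by (simp add: \<alpha>_def)
  also have "L2_set (\<lambda>p. block d x i p - (block d Y i p + g p)) {..<d}
      = L2_set (\<lambda>p. e i p + (- 1) * g p) {..<d}"
    by (simp add: e_def algebra_simps)
  also have "\<alpha> * L2_set (\<lambda>p. e i p + (- 1) * g p) {..<d} + L2_set g {..<d}
      \<le> \<alpha> * (L2_set (e i) {..<d} + L2_set (\<lambda>p. (- 1) * g p) {..<d}) + L2_set g {..<d}"
    using \<alpha>(1) by (intro add_right_mono mult_left_mono L2_set_triangle_ineq)
  also have "L2_set (\<lambda>p. (- 1) * g p) {..<d} = L2_set g {..<d}" by (subst L2_set_cmult) simp
  \<comment> \<open>The defect enters once at the start, damped by \<alpha>, and once at the end,
    hence the factor 2. With \<open>2 / b\<close> and \<open>b = dt * \<gamma>\<close> this becomes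
    \<open>4 / \<gamma>\<close>.\<close>
  also have "\<alpha> * (L2_set (e i) {..<d} + L2_set g {..<d}) + L2_set g {..<d}
      \<le> \<alpha> * L2_set (e i) {..<d} + 2 * L2_set g {..<d}"
    using mult_right_mono[OF \<alpha>(2) L2_set_nonneg[of g "{..<d}"]] by (simp add: distrib_left)
  also have "2 * L2_set g {..<d} \<le> 2 * (2 / b * (dt * (\<Sum>j<i. \<bar>A $$ (i, j)\<bar> * L2_set (e j) {..<d})))"
  proof -
    have "L2_set z {..<d} = dt * L2_set (\<lambda>p. \<Sum>j<m. ?S j * e j p) {..<d}"
      unfolding z_def[abs_def] L2_set_cmult using dt by simp
    also have "L2_set (\<lambda>p. \<Sum>j<m. ?S j * e j p) {..<d} \<le> (\<Sum>j<m. L2_set (\<lambda>p. ?S j * e j p) {..<d})"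
      by (rule L2_set_sum) simp
    also have "\<dots> = (\<Sum>j<m. \<bar>?S j\<bar> * L2_set (e j) {..<d})" by (simp only: L2_set_cmult)
    \<comment> \<open>The diagonal of \<open>A\<close> minus \<gamma> is zero and \<open>A\<close>
      is lower triangular, so only earlier stages couple.\<close>
    also have "\<dots> = (\<Sum>j<i. \<bar>?S j\<bar> * L2_set (e j) {..<d})"
      using i A by (intro sum.mono_neutral_right) (auto simp: sdirk_matrix_def not_less le_less)
    also have "\<dots> = (\<Sum>j<i. \<bar>A $$ (i, j)\<bar> * L2_set (e j) {..<d})" by (intro sum.cong) auto
    finally have "L2_set z {..<d} \<le> dt * (\<Sum>j<i. \<bar>A $$ (i, j)\<bar> * L2_set (e j) {..<d})"
      using dt by simp
    then have "2 / b * L2_set z {..<d} \<le> 2 / b * (dt * (\<Sum>j<i. \<bar>A $$ (i, j)\<bar> * L2_set (e j) {..<d}))"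
      using b by (intro mult_left_mono) auto
    then show ?thesis using gz by linarith
  qed
  also have "2 * (2 / b * (dt * (\<Sum>j<i. \<bar>A $$ (i, j)\<bar> * L2_set (e j) {..<d})))
      = 4 / \<gamma> * (\<Sum>j<i. \<bar>A $$ (i, j)\<bar> * L2_set (e j) {..<d})"
    using dt by (simp add: b_def)
  also have "L2_set (e i) {..<d} = L2_set (block d (x - Y) i) {..<d}"
    using i by (intro L2_set_cong) (auto simp: e)
  also have "(\<Sum>j<i. \<bar>A $$ (i, j)\<bar> * L2_set (e j) {..<d})
      = (\<Sum>j<i. \<bar>A $$ (i, j)\<bar> * L2_set (block d (x - Y) j) {..<d})"
  proof (intro sum.cong refl)
    fix j assume "j \<in> {..<i}"
    then have "L2_set (e j) {..<d} = L2_set (block d (x - Y) j) {..<d}"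
      using i by (intro L2_set_cong) (auto simp: e)
    then show "\<bar>A $$ (i, j)\<bar> * L2_set (e j) {..<d} = \<bar>A $$ (i, j)\<bar> * L2_set (block d (x - Y) j) {..<d}"
      by simp
  qed
  finally show ?thesis by (simp add: \<alpha>_def)
qed


section \<open>Convergence\<close>

text \<open>The proof measures the errors by their sum weighted with \<open>\<delta> ^ i\<close> for a small \<open>\<delta>\<close>.\<close>

lemma triangular_recurrence_bound:
  fixes b \<epsilon> :: real and m :: nat
  assumes b: "b \<ge> 0" and \<epsilon>: "\<epsilon> > 0"
  obtains C where "C > 0"
    "\<And>\<alpha> n k. \<lbrakk>0 \<le> \<alpha>; \<And>k i. i < m \<Longrightarrow> 0 \<le> n k i;
      \<And>k i. i < m \<Longrightarrow> n (Suc k) i \<le> \<alpha> * n k i + b * (\<Sum>j<i. n k j)\<rbrakk>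
      \<Longrightarrow> (\<Sum>i<m. n k i) \<le> C * (\<alpha> + \<epsilon>) ^ k * (\<Sum>i<m. n 0 i)"
proof -
  \<comment> \<open>Chosen so that \<open>b * real m * \<delta> \<le> \<epsilon>\<close>; the cap at
    1 makes the weights decreasing.\<close>
  define \<delta> where "\<delta> = min 1 (\<epsilon> / (b * real m + 1))"
  have bm: "b * real m + 1 > 0" using b by (simp add: add_nonneg_pos)
  then have \<delta>: "0 < \<delta>" "\<delta> \<le> 1" using \<epsilon> by (simp_all add: \<delta>_def)
  have "b * real m * \<delta> \<le> (b * real m + 1) * (\<epsilon> / (b * real m + 1))"
    using b \<delta> bm by (intro mult_mono) (auto simp: \<delta>_def)
  then have \<delta>\<epsilon>: "b * real m * \<delta> \<le> \<epsilon>" using bm by simp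
  show ?thesis
  proof (rule that)
    \<comment> \<open>The constant is fixed before \<alpha> and \<open>n\<close>, so a single one
      serves all mesh sizes.\<close>
    show "1 / \<delta> ^ m > 0" using \<delta> by simp
    fix \<alpha> :: real and n :: "nat \<Rightarrow> nat \<Rightarrow> real" and k
    assume \<alpha>: "0 \<le> \<alpha>" and nn: "\<And>k i. i < m \<Longrightarrow> 0 \<le> n k i"
      and rec: "\<And>k i. i < m \<Longrightarrow> n (Suc k) i \<le> \<alpha> * n k i + b * (\<Sum>j<i. n k j)"
    define F where "F k = (\<Sum>i<m. \<delta> ^ i * n k i)" for k
    have step: "F (Suc k) \<le> (\<alpha> + \<epsilon>) * F k" for k
    proof -
      have F0: "F k \<ge> 0" unfolding F_def using nn \<delta> by (intro sum_nonneg) auto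
      have "F (Suc k) \<le> (\<Sum>i<m. \<alpha> * (\<delta> ^ i * n k i) + b * (\<delta> * F k))"
        unfolding F_def[of "Suc k"]
      proof (rule sum_mono)
        fix i assume "i \<in> {..<m}"
        then have i: "i < m" by simp
        \<comment> \<open>Each coupling goes from a stage \<open>j < i\<close> to \<open>i\<close>,
          so its weight gains at least one factor \<delta>.\<close>
        have "(\<Sum>j<i. \<delta> ^ i * n k j) \<le> (\<Sum>j<i. \<delta> * (\<delta> ^ j * n k j))"
        proof (rule sum_mono)
          fix j assume j: "j \<in> {..<i}"
          then have "\<delta> ^ i \<le> \<delta> ^ Suc j" using \<delta> by (intro power_decreasing) auto
          then show "\<delta> ^ i * n k j \<le> \<delta> * (\<delta> ^ j * n k j)"
            using mult_right_mono[of "\<delta> ^ i" "\<delta> ^ Suc j" "n k j"] nn[of j k] i j by (simp add: mult.assoc)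
        qed
        also have "\<dots> \<le> (\<Sum>j<m. \<delta> * (\<delta> ^ j * n k j))"
          using i \<delta> nn by (intro sum_mono2) auto
        also have "\<dots> = \<delta> * F k" by (simp add: F_def sum_distrib_left)
        finally have "b * (\<Sum>j<i. \<delta> ^ i * n k j) \<le> b * (\<delta> * F k)" using b by (rule mult_left_mono)
        moreover have "\<delta> ^ i * n (Suc k) i \<le> \<delta> ^ i * (\<alpha> * n k i + b * (\<Sum>j<i. n k j))"
          using rec[OF i] \<delta> by (intro mult_left_mono) auto
        ultimately show "\<delta> ^ i * n (Suc k) i \<le> \<alpha> * (\<delta> ^ i * n k i) + b * (\<delta> * F k)"
          by (simp add: distrib_left sum_distrib_left[symmetric] mult_ac)
      qed
      also have "\<dots> = \<alpha> * F k + b * real m * \<delta> * F k"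
        by (simp add: F_def sum.distrib sum_distrib_left mult_ac)
      also have "\<dots> \<le> (\<alpha> + \<epsilon>) * F k" using mult_right_mono[OF \<delta>\<epsilon> F0] by (simp add: distrib_right)
      finally show ?thesis .
    qed
    have "F k \<le> (\<alpha> + \<epsilon>) ^ k * F 0"
    proof (induction k)
      case (Suc k)
      have "(\<alpha> + \<epsilon>) * F k \<le> (\<alpha> + \<epsilon>) * ((\<alpha> + \<epsilon>) ^ k * F 0)"
        using Suc \<alpha> \<epsilon> by (intro mult_left_mono) auto
      with step[of k] show ?case by (simp add: mult.assoc)
    qed simp
    also have "\<dots> \<le> (\<alpha> + \<epsilon>) ^ k * (\<Sum>i<m. n 0 i)"
      unfolding F_def using \<delta> nn \<alpha> \<epsilon> by (intro mult_left_mono sum_mono) (auto intro!: mult_left_le_one_le power_le_one)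
    finally have "F k \<le> (\<alpha> + \<epsilon>) ^ k * (\<Sum>i<m. n 0 i)" .
    moreover have "\<delta> ^ m * (\<Sum>i<m. n k i) \<le> F k"
      unfolding F_def sum_distrib_left using \<delta> nn by (intro sum_mono mult_right_mono power_decreasing) auto
    ultimately have "\<delta> ^ m * (\<Sum>i<m. n k i) \<le> (\<alpha> + \<epsilon>) ^ k * (\<Sum>i<m. n 0 i)" by linarith
    then show "(\<Sum>i<m. n k i) \<le> 1 / \<delta> ^ m * (\<alpha> + \<epsilon>) ^ k * (\<Sum>i<m. n 0 i)"
      using \<delta> by (simp add: field_simps)
  qed
qed

text \<open>Since \<open>\<kappa> - 1 = \<gamma> * dt * lmax\<close>, the radicand in
  \<open>rkc_stages\<close> is the left side of the second claim. Its positivity makes the ceiling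
  at least 1.\<close>

lemma rkc_stages_stable:
  assumes "\<eta> > 0" "\<gamma> * dt * lmax > 0"
  shows "rkc_stages (rkc_kappa \<gamma> dt lmax) \<eta> \<ge> 1"
    and "\<gamma> * dt * (lmax / 2) * \<eta> \<le> (real (rkc_stages (rkc_kappa \<gamma> dt lmax) \<eta>))\<^sup>2"
proof -
  let ?s = "rkc_stages (rkc_kappa \<gamma> dt lmax) \<eta>"
  define r where "r = \<gamma> * dt * (lmax / 2) * \<eta>"
  have r: "r > 0" using assms by (simp add: r_def)
  have s: "?s = nat \<lceil>sqrt r\<rceil>"
    by (simp add: rkc_stages_def rkc_kappa_def rkc_L_def rkc_ell_def r_def algebra_simps)
  have "sqrt r \<le> real ?s" unfolding s by (rule real_nat_ceiling_ge)
  moreover have "sqrt r > 0" using r by simp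
  ultimately show "?s \<ge> 1" by linarith
  have "(sqrt r)\<^sup>2 \<le> (real ?s)\<^sup>2"
    using \<open>sqrt r \<le> real ?s\<close> \<open>sqrt r > 0\<close> by (intro power_mono) auto
  then show "\<gamma> * dt * (lmax / 2) * \<eta> \<le> (real ?s)\<^sup>2" using r by (simp add: r_def)
qed

lemma prkc_iterate_carrier:
  assumes "A \<in> carrier_mat m m" "D \<in> carrier_mat d d" "y \<in> carrier_vec d" "x \<in> carrier_vec (m * d)"
  shows "prkc_iterate m \<gamma> A D dt \<eta> s y x k \<in> carrier_vec (m * d)"
  by (induction k) (simp_all add: assms prkc_step_carrier)

theorem theorem4p2:
  fixes N m :: nat and a dt \<eta> \<gamma> :: real and A :: "real mat"
  assumes "N \<in> {1, 2, 3}" and "a > 0" and "dt > 0" and "\<eta> > 0"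
    and "m \<ge> 1" and "sdirk_matrix m \<gamma> A"
  shows "\<forall>\<epsilon>>0. \<exists>C :: real. \<forall>M\<ge>1.
    let d = M ^ N;
        D = neg_laplacian N M a;
        s = rkc_stages (rkc_kappa \<gamma> dt (lambda_max N M a)) \<eta>
    in \<forall>y \<in> carrier_vec d.
         (\<exists>!Y. sdirk_solution m A D dt y Y) \<and>
         (\<forall>Y. sdirk_solution m A D dt y Y \<longrightarrow>
           (\<forall>x\<^sub>0 \<in> carrier_vec (m * d).
             let x = prkc_iterate m \<gamma> A D dt \<eta> s y x\<^sub>0
             in (\<lambda>k. norm2 (x k - Y)) \<longlonglongrightarrow> 0 \<and>
                (\<forall>k. norm2 (x k - Y) \<le> C * (rkc_alpha \<eta> s + \<epsilon>) ^ k * norm2 (x\<^sub>0 - Y))))"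
proof -
  have N: "N \<ge> 1" using assms(1) by auto
  have \<gamma>: "\<gamma> > 0" and A: "A \<in> carrier_mat m m" using assms(6) by (simp_all add: sdirk_matrix_def)
  \<comment> \<open>A common bound for the entries of \<open>A\<close>, giving all couplings the
    same constant \<open>b\<close>.\<close>
  define S where "S = (\<Sum>i<m. \<Sum>j<m. \<bar>A $$ (i, j)\<bar>)"
  have S0: "S \<ge> 0" by (simp add: S_def sum_nonneg)
  have S: "\<bar>A $$ (i, j)\<bar> \<le> S" if "i < m" "j < m" for i j
  proof -
    have "\<bar>A $$ (i, j)\<bar> \<le> (\<Sum>j<m. \<bar>A $$ (i, j)\<bar>)" using that by (intro member_le_sum) auto
    also have "\<dots> \<le> S" unfolding S_def using that by (intro member_le_sum) (auto intro: sum_nonneg)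
    finally show ?thesis .
  qed
  define b where "b = 4 / \<gamma> * S"
  have b: "b \<ge> 0" using \<gamma> S0 by (simp add: b_def)
  have setting: "symm_substochastic (M ^ N) (neighbour_mean N M)" "lambda_max N M a / 2 \<ge> 0"
    "neg_laplacian N M a \<in> carrier_mat (M ^ N) (M ^ N)"
    "rkc_stages (rkc_kappa \<gamma> dt (lambda_max N M a)) \<eta> \<ge> 1"
    "\<gamma> * dt * (lambda_max N M a / 2) * \<eta> \<le> (real (rkc_stages (rkc_kappa \<gamma> dt (lambda_max N M a)) \<eta>))\<^sup>2"
    if "M \<ge> 1" for M
  proof -
    have l: "lambda_max N M a > 0" using that N assms(2) by (simp add: lambda_max_def mesh_size_def)
    then have "\<gamma> * dt * lambda_max N M a > 0" using \<gamma> assms(3) by simp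
    then show "rkc_stages (rkc_kappa \<gamma> dt (lambda_max N M a)) \<eta> \<ge> 1"
      "\<gamma> * dt * (lambda_max N M a / 2) * \<eta> \<le> (real (rkc_stages (rkc_kappa \<gamma> dt (lambda_max N M a)) \<eta>))\<^sup>2"
      using rkc_stages_stable assms(4) by blast+
    show "lambda_max N M a / 2 \<ge> 0" using l by simp
  qed (use N that in \<open>auto simp: neg_laplacian_def intro: neighbour_mean_substochastic\<close>)
  define step where "step M = rkc_stages (rkc_kappa \<gamma> dt (lambda_max N M a)) \<eta>" for M
  define it where "it M = prkc_iterate m \<gamma> A (neg_laplacian N M a) dt \<eta> (step M)" for M
  have bound: "\<exists>C :: real. \<forall>M\<ge>1. \<forall>y \<in> carrier_vec (M ^ N). \<forall>Y. sdirk_solution m A (neg_laplacian N M a) dt y Y \<longrightarrow>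
      (\<forall>x \<in> carrier_vec (m * M ^ N). \<forall>k.
        norm2 (it M y x k - Y) \<le> C * (rkc_alpha \<eta> (step M) + \<epsilon>) ^ k * norm2 (x - Y))"
    if \<epsilon>: "\<epsilon> > 0" for \<epsilon> :: real
  proof -
    \<comment> \<open>\<open>C\<close> is obtained before \<open>M\<close> and depends only on
      \<open>b\<close>, \<epsilon> and \<open>m\<close>: this is the independence of the
      dimension.\<close>
    obtain C where C: "C > 0"
      "\<And>\<alpha> n k. \<lbrakk>0 \<le> \<alpha>; \<And>k i. i < m \<Longrightarrow> 0 \<le> n k i;
        \<And>k i. i < m \<Longrightarrow> n (Suc k) i \<le> \<alpha> * n k i + b * (\<Sum>j<i. n k j)\<rbrakk>
        \<Longrightarrow> (\<Sum>i<m. n k i) \<le> C * (\<alpha> + \<epsilon>) ^ k * (\<Sum>i<m. n 0 i)"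
      using triangular_recurrence_bound[OF b \<epsilon>, of m] by metis
    show ?thesis
    proof (intro exI[of _ "C * real m"] allI impI ballI)
      fix M k :: nat and y Y x :: "real vec"
      assume M: "M \<ge> 1" and y: "y \<in> carrier_vec (M ^ N)"
        and Y: "sdirk_solution m A (neg_laplacian N M a) dt y Y" and x: "x \<in> carrier_vec (m * M ^ N)"
      let ?\<alpha> = "rkc_alpha \<eta> (step M)"
      note set = setting[OF M, folded step_def]
      have car: "it M y x k \<in> carrier_vec (m * M ^ N)" for k
        unfolding it_def by (rule prkc_iterate_carrier[OF A set(3) y x])
      have Yc: "Y \<in> carrier_vec (m * M ^ N)" using Y y by (simp add: sdirk_solution_def)
      have diff: "it M y x k - Y \<in> carrier_vec (m * M ^ N)" for k using car Yc by auto
      define n where "n k i = L2_set (block (M ^ N) (it M y x k - Y) i) {..<M ^ N}" for k i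
      have \<alpha>: "0 \<le> ?\<alpha>" using rkc_alpha_bounds[OF assms(4) set(4)] by simp
      have "(\<Sum>i<m. n k i) \<le> C * (?\<alpha> + \<epsilon>) ^ k * (\<Sum>i<m. n 0 i)"
      proof (rule C(2)[OF \<alpha>])
        fix k i assume i: "i < m"
        show "0 \<le> n k i" by (simp add: n_def L2_set_nonneg)
        have "it M y x (Suc k) = prkc_step m \<gamma> A (neg_laplacian N M a) dt \<eta> (step M) y (it M y x k)"
          by (simp add: it_def)
        then have "n (Suc k) i \<le> ?\<alpha> * n k i + 4 / \<gamma> * (\<Sum>j<i. \<bar>A $$ (i, j)\<bar> * n k j)"
          unfolding n_def
          using prkc_step_error[OF set(1,2) assms(3,6) set(3) neg_laplacian_app[OF N] y Y car assms(4) set(4,5) i]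
          by simp
        also have "(\<Sum>j<i. \<bar>A $$ (i, j)\<bar> * n k j) \<le> (\<Sum>j<i. S * n k j)"
          using S i by (intro sum_mono mult_right_mono) (auto simp: n_def L2_set_nonneg)
        finally show "n (Suc k) i \<le> ?\<alpha> * n k i + b * (\<Sum>j<i. n k j)"
          using \<gamma> by (simp add: b_def sum_distrib_left divide_right_mono mult.assoc)
      qed
      moreover have "norm2 (it M y x k - Y) \<le> (\<Sum>i<m. n k i)"
        unfolding n_def by (rule norm2_le_sum_blocks[OF diff])
      moreover have "C * (?\<alpha> + \<epsilon>) ^ k * (\<Sum>i<m. n 0 i) \<le> C * (?\<alpha> + \<epsilon>) ^ k * (real m * norm2 (x - Y))"
        using sum_blocks_le_norm2[OF diff[of 0]] C(1) \<alpha> \<epsilon>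
        by (intro mult_left_mono) (auto simp: n_def it_def)
      ultimately show "norm2 (it M y x k - Y) \<le> C * real m * (?\<alpha> + \<epsilon>) ^ k * norm2 (x - Y)"
        by (simp add: mult_ac)
    qed
  qed
  have conv: "(\<lambda>k. norm2 (it M y x k - Y)) \<longlonglongrightarrow> 0"
    if prems: "M \<ge> 1" "y \<in> carrier_vec (M ^ N)" "sdirk_solution m A (neg_laplacian N M a) dt y Y"
      "x \<in> carrier_vec (m * M ^ N)" for M and y Y x :: "real vec"
  proof -
    let ?\<alpha> = "rkc_alpha \<eta> (step M)"
    have \<alpha>: "0 < ?\<alpha>" "?\<alpha> < 1"
      using rkc_alpha_bounds[OF assms(4) setting(4)[OF prems(1)]] by (simp_all add: step_def)
    \<comment> \<open>For a prescribed \<epsilon> the rate may exceed 1, so convergence uses its own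
      tolerance, which depends on the mesh and yields the rate
      \<open>(1 + ?\<alpha>) / 2 < 1\<close>.\<close>
    then have "(1 - ?\<alpha>) / 2 > 0" by simp
    from bound[OF this] obtain C
      where C: "norm2 (it M y x k - Y) \<le> C * (?\<alpha> + (1 - ?\<alpha>) / 2) ^ k * norm2 (x - Y)" for k
      using prems by (elim exE) blast
    have "(\<lambda>k. (?\<alpha> + (1 - ?\<alpha>) / 2) ^ k) \<longlonglongrightarrow> 0"
      using \<alpha> by (intro LIMSEQ_realpow_zero) (simp_all add: field_simps)
    then have lim: "(\<lambda>k. C * (?\<alpha> + (1 - ?\<alpha>) / 2) ^ k * norm2 (x - Y)) \<longlonglongrightarrow> 0"
      by (intro tendsto_mult_left_zero tendsto_mult_right_zero)
    have nonneg: "norm2 v \<ge> 0" for v by (simp add: norm2_def scalar_prod_def sum_nonneg)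
    show ?thesis
      by (rule tendsto_sandwich[OF always_eventually always_eventually tendsto_const lim])
        (rule allI, rule nonneg C)+
  qed
  have unique: "\<exists>!Y. sdirk_solution m A (neg_laplacian N M a) dt y Y"
    if M: "M \<ge> 1" and y: "y \<in> carrier_vec (M ^ N)" for M y
    by (rule sdirk_solution_ex1[OF setting(1,2)[OF M] less_imp_le[OF assms(3)] assms(6)
        setting(3)[OF M] neg_laplacian_app[OF N] y])
  show ?thesis
  proof (intro allI impI)
    fix \<epsilon> :: real assume "\<epsilon> > 0"
    from bound[OF this] show "\<exists>C. \<forall>M\<ge>1.
      let d = M ^ N;
          D = neg_laplacian N M a;
          s = rkc_stages (rkc_kappa \<gamma> dt (lambda_max N M a)) \<eta>
      in \<forall>y \<in> carrier_vec d.
           (\<exists>!Y. sdirk_solution m A D dt y Y) \<and>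
           (\<forall>Y. sdirk_solution m A D dt y Y \<longrightarrow>
             (\<forall>x\<^sub>0 \<in> carrier_vec (m * d).
               let x = prkc_iterate m \<gamma> A D dt \<eta> s y x\<^sub>0
               in (\<lambda>k. norm2 (x k - Y)) \<longlonglongrightarrow> 0 \<and>
                  (\<forall>k. norm2 (x k - Y) \<le> C * (rkc_alpha \<eta> s + \<epsilon>) ^ k * norm2 (x\<^sub>0 - Y))))"
      unfolding Let_def step_def[symmetric] it_def[symmetric]
      using conv unique by (elim exE) (rule exI, blast)
  qed
qed

end
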